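(* Let $T$ be a (graph) forest with at least one edge and let $k\geq 4$ be an integer. Then, with $T$ and $k$ fixed and $n\to\infty$, $$\mathrm{ex}_k(n,T^{(k)})=\bigl(\sigma(T)-1+o(1)\bigr)\binom{n}{k-1}.$$
   Context: For a graph $H$ and integer $k\geq 2$, the $k$-expansion $H^{(k)}$ is the $k$-uniform hypergraph obtained by replacing each edge $xy$ of $H$ by a $k$-set $E_{xy}$ consisting of $x,y$ and $k-2$ new vertices, where the sets $E_{xy}\setminus\{x,y\}$ are pairwise disjoint for distinct edges and disjoint from $V(H)$. For a forest $T$, $$\sigma(T):=\min\{|X|+e(T\setminus X): X\subseteq V(T)\text{ independent in }T\},$$ where $T\setminus X$ is the graph obtained by deleting the vertices of $X$ and all edges incident to them, and $e(G)$ is the number of edges of $G$. $\mathrm{ex}_k(n,H)$ is the maximum number of edges of a $k$-uniform hypergraph on $n$ vertices containing no subhypergraph isomorphic to $H$. *)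

theory Defs
  imports Complex_Main
begin

definition graph :: "'a set \<Rightarrow> 'a set set \<Rightarrow> bool" where
  "graph V E \<longleftrightarrow> finite V \<and> (\<forall>e\<in>E. \<exists>x y. x \<noteq> y \<and> x \<in> V \<and> y \<in> V \<and> e = {x, y})"

definition has_cycle :: "'a set \<Rightarrow> 'a set set \<Rightarrow> bool" where
  "has_cycle V E \<longleftrightarrow> (\<exists>vs. length vs \<ge> 3 \<and> distinct vs \<and> set vs \<subseteq> V \<and>
     (\<forall>i < length vs. {vs ! i, vs ! ((i + 1) mod length vs)} \<in> E))"

definition forest :: "'a set \<Rightarrow> 'a set set \<Rightarrow> bool" where
  "forest V E \<longleftrightarrow> graph V E \<and> \<not> has_cycle V E"

definition independent :: "'a set \<Rightarrow> 'a set set \<Rightarrow> 'a set \<Rightarrow> bool" where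
  "independent V E X \<longleftrightarrow> X \<subseteq> V \<and> (\<forall>e\<in>E. \<not> e \<subseteq> X)"

text \<open>sigma(T) = min over independent X of |X| + e(T \ X); the edges of T \ X are
  the edges disjoint from X.\<close>
definition sigma :: "'a set \<Rightarrow> 'a set set \<Rightarrow> nat" where
  "sigma V E = Min ((\<lambda>X. card X + card {e\<in>E. e \<inter> X = {}}) ` {X. independent V E X})"

text \<open>k-expansion: original vertices Inl v, new vertices Inr (e, i) with i < k - 2
  for each edge e.\<close>
definition expansion_vertices :: "nat \<Rightarrow> 'a set \<Rightarrow> 'a set set \<Rightarrow> ('a + 'a set \<times> nat) set" where
  "expansion_vertices k V E = Inl ` V \<union> {Inr (e, i) | e i. e \<in> E \<and> i < k - 2}"

definition expansion_edges :: "nat \<Rightarrow> 'a set \<Rightarrow> 'a set set \<Rightarrow> ('a + 'a set \<times> nat) set set" where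
  "expansion_edges k V E = (\<lambda>e. Inl ` e \<union> {Inr (e, i) | i. i < k - 2}) ` E"

definition contains_copy :: "nat set set \<Rightarrow> 'b set \<Rightarrow> 'b set set \<Rightarrow> bool" where
  "contains_copy F W H \<longleftrightarrow> (\<exists>f. inj_on f W \<and> (\<forall>h\<in>H. f ` h \<in> F))"

definition ex_k :: "nat \<Rightarrow> nat \<Rightarrow> 'b set \<Rightarrow> 'b set set \<Rightarrow> nat" where
  "ex_k k n W H = Max (card ` {F. F \<subseteq> {S. S \<subseteq> {..<n} \<and> card S = k} \<and> \<not> contains_copy F W H})"

end

theory Submission
  imports Defs
begin

text \<open>
  Lower bound: fix \<open>\<sigma> - 1\<close> points and take all \<open>k\<close>-sets meeting them exactly once. A copy of the
  expansion would induce a crosscut of \<open>T\<close> of cost at most \<open>\<sigma> - 1\<close>.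

  Upper bound: if some subfamily has all its \<open>(k-1)\<close>-shadows of large codegree, the expansion embeds
  greedily. Otherwise one can peel the family so that every edge is \<open>e = c(e) \<union> {a(e)}\<close>, where each
  \<open>(k-1)\<close>-set is \<open>c(e)\<close> for boundedly many \<open>e\<close>; call \<open>a(e)\<close> the centre of \<open>e\<close>. Only boundedly many
  vertices are the centre of \<open>\<delta> n\<^sup>k\<^sup>-\<^sup>1\<close> edges. If \<open>\<epsilon> n\<^sup>k\<^sup>-\<^sup>1\<close> edges have other centres, then almost
  all of these have at most one vertex \<open>x \<in> c(e)\<close> for which the pair \<open>(a(e), x)\<close> is heavy; the
  remaining \<open>k - 2 \<ge> 2\<close> vertices can serve as vertices of \<open>T\<close> in a greedy embedding. This is where
  \<open>k \<ge> 4\<close> enters. If instead more than \<open>(\<sigma> - 1 + \<epsilon>) (n choose (k-1))\<close> edges have popular centres, a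
  positive proportion of all \<open>(k-1)\<close>-sets share \<open>\<sigma>\<close> centres. An optimal crosscut of \<open>T\<close> goes to these
  centres and the rest of the expansion embeds greedily into the dense \<open>(k-1)\<close>-uniform common link.
\<close>

section \<open>Peeling\<close>

text \<open>As long as some key \<open>x\<close> lies in at most \<open>m\<close> of the sets
  \<open>G e\<close>, delete all \<open>e\<close> with \<open>x \<in> G e\<close> and put
  \<open>c e = x\<close> for them. No survivor has the key \<open>x\<close>, so it is never chosen
  again and its fibre stays within \<open>m\<close>. Only a family in which every key is frequent
  stops the process early.\<close>

lemma dense_subfamily_or_sparse_choice:
  fixes G :: "'e \<Rightarrow> 'x set"
  assumes "finite P"
  shows "(\<exists>Q\<subseteq>P. Q \<noteq> {} \<and> (\<forall>e\<in>Q. \<forall>x\<in>G e. m < card {e'\<in>Q. x \<in> G e'})) \<or>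
         (\<exists>c. (\<forall>e\<in>P. c e \<in> G e) \<and> (\<forall>x. card {e\<in>P. c e = x} \<le> m))"
  using assms
proof (induction P rule: finite_psubset_induct)
  case (psubset P)
  consider "P = {}" | "P \<noteq> {}" "\<forall>e\<in>P. \<forall>x\<in>G e. m < card {e'\<in>P. x \<in> G e'}"
    | "\<not> (\<forall>e\<in>P. \<forall>x\<in>G e. m < card {e'\<in>P. x \<in> G e'})" by blast
  then show ?case
  proof cases
    case 1
    then show ?thesis by simp
  next
    case 2
    then show ?thesis by (intro disjI1 exI[of _ P] conjI order.refl)
  next
    case 3
    then obtain e0 x0 where e0: "e0 \<in> P" "x0 \<in> G e0" "card {e\<in>P. x0 \<in> G e} \<le> m"
      by (auto simp: not_less)
    define R where "R = {e\<in>P. x0 \<in> G e}"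
    have "P - R \<subset> P" using e0 by (auto simp: R_def)
    from psubset.IH[OF this] show ?thesis
    proof (elim disjE exE conjE)
      fix Q assume "Q \<subseteq> P - R" "Q \<noteq> {}" "\<forall>e\<in>Q. \<forall>x\<in>G e. m < card {e'\<in>Q. x \<in> G e'}"
      then show ?thesis by (intro disjI1 exI[of _ Q] conjI) (auto simp only:)
    next
      fix c assume c: "\<forall>e\<in>P - R. c e \<in> G e" "\<forall>x. card {e\<in>P - R. c e = x} \<le> m"
      define c' where "c' e = (if e \<in> R then x0 else c e)" for e
      have "card {e\<in>P. c' e = x} \<le> m" for x
      proof (cases "x = x0")
        case True
        then have "{e\<in>P. c' e = x} = R" using c(1) by (auto simp: c'_def R_def)
        then show ?thesis using e0(3) R_def by simp
      next
        case False
        then have "{e\<in>P. c' e = x} = {e\<in>P - R. c e = x}" by (auto simp: c'_def)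
        then show ?thesis using c(2) by simp
      qed
      moreover have "\<forall>e\<in>P. c' e \<in> G e" using c(1) by (auto simp: c'_def R_def)
      ultimately show ?thesis by (intro disjI2 exI[of _ c'] conjI allI)
    qed
  qed
qed

text \<open>A sparse choice would map \<open>P\<close> into \<open>Y\<close> with fibres of size at
  most \<open>m\<close>, which the size of \<open>P\<close> rules out.\<close>

lemma dense_subfamily:
  fixes G :: "'e \<Rightarrow> 'x set"
  assumes "finite P" and "finite Y" and "\<And>e. e \<in> P \<Longrightarrow> G e \<subseteq> Y" and "card Y * m < card P"
  obtains Q where "Q \<subseteq> P" "Q \<noteq> {}" "\<And>e x. e \<in> Q \<Longrightarrow> x \<in> G e \<Longrightarrow> m < card {e'\<in>Q. x \<in> G e'}"
proof -
  have "\<not> (\<exists>c. (\<forall>e\<in>P. c e \<in> G e) \<and> (\<forall>x. card {e\<in>P. c e = x} \<le> m))"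
  proof
    assume "\<exists>c. (\<forall>e\<in>P. c e \<in> G e) \<and> (\<forall>x. card {e\<in>P. c e = x} \<le> m)"
    then obtain c where c: "\<forall>e\<in>P. c e \<in> G e" "\<forall>x. card {e\<in>P. c e = x} \<le> m" by blast
    have "P \<subseteq> (\<Union>x\<in>Y. {e\<in>P. c e = x})" using c(1) assms(3) by blast
    then have "card P \<le> card (\<Union>x\<in>Y. {e\<in>P. c e = x})"
      using assms(1,2) by (intro card_mono) auto
    also have "\<dots> \<le> (\<Sum>x\<in>Y. card {e\<in>P. c e = x})" by (rule card_UN_le) fact
    also have "\<dots> \<le> (\<Sum>x\<in>Y. m)" using c(2) by (intro sum_mono) auto
    finally show False using assms(4) by simp
  qed
  then show thesis using dense_subfamily_or_sparse_choice[OF assms(1), of G m] that by blast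
qed

section \<open>Greedy embedding\<close>

text \<open>The vertices in \<open>G e\<close> are those of \<open>e\<close> at which a new edge can be attached.\<close>
definition flexible :: "nat \<Rightarrow> nat \<Rightarrow> 'v set set \<Rightarrow> ('v set \<Rightarrow> 'v set) \<Rightarrow> bool" where
  "flexible r C P G \<longleftrightarrow> P \<noteq> {} \<and>
     (\<forall>e\<in>P. finite e \<and> card e = r \<and> G e \<subseteq> e \<and> 2 \<le> card (G e)) \<and>
     (\<forall>x\<in>\<Union>(G ` P). \<forall>U. finite U \<longrightarrow> card U \<le> C \<longrightarrow> x \<notin> U \<longrightarrow> (\<exists>e\<in>P. x \<in> G e \<and> e \<inter> U = {}))"

text \<open>\<open>flexible\<close> lets an edge be attached only at a vertex outside
  \<open>U\<close>, and a given attaching vertex \<open>x\<close> may lie in \<open>U\<close>. So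
  first take an edge meeting \<open>U\<close> at most in \<open>x\<close>; as
  \<open>2 \<le> card (G e)\<close>, it has another attaching vertex \<open>y\<close>, which is
  free, and some edge through \<open>y\<close> avoids \<open>U\<close> altogether.\<close>

lemma flexible_avoid:
  assumes "flexible r C P G" and "finite U" and "card U \<le> C"
  obtains e where "e \<in> P" "e \<inter> U = {}"
proof -
  from assms(1) obtain e0 where e0: "e0 \<in> P" "2 \<le> card (G e0)" by (auto simp: flexible_def)
  then obtain x where x: "x \<in> G e0" by fastforce
  have fl: "\<exists>e\<in>P. x \<in> G e \<and> e \<inter> U = {}"
    if "e' \<in> P" "x \<in> G e'" "finite U" "card U \<le> C" "x \<notin> U" for x U e'
    using assms(1) that unfolding flexible_def by blast
  have "card (U - {x}) \<le> C" using assms(2,3) by (meson card_Diff1_le le_trans)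
  then obtain e1 where e1: "e1 \<in> P" "x \<in> G e1" "e1 \<inter> (U - {x}) = {}"
    using fl[OF e0(1) x, of "U - {x}"] assms(2) by auto
  have "2 \<le> card (G e1)" "G e1 \<subseteq> e1" using e1(1) assms(1) by (auto simp: flexible_def)
  have "\<not> G e1 \<subseteq> {x}"
  proof
    assume "G e1 \<subseteq> {x}"
    then have "card (G e1) \<le> card {x}" by (intro card_mono) auto
    then show False using \<open>2 \<le> card (G e1)\<close> by simp
  qed
  then obtain y where "y \<in> G e1" "y \<noteq> x" by blast
  moreover from this have "y \<notin> U" using e1 \<open>G e1 \<subseteq> e1\<close> by auto
  ultimately show thesis using fl[OF e1(1), of y U] assms(2,3) that by blast
qed

lemma flexible_extend:
  assumes "flexible r C P G" and "e' \<in> P" and "x \<in> G e'" and "finite U" and "card U \<le> C" and "x \<notin> U"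
  obtains e where "e \<in> P" "x \<in> G e" "e \<inter> U = {}"
  using assms unfolding flexible_def by blast

lemma bij_betw_respecting:
  assumes "finite A" "finite B" "card A = card B" "Q \<subseteq> A" "R \<subseteq> B" "card Q \<le> card R"
  obtains g where "bij_betw g A B" "g ` Q \<subseteq> R"
proof -
  obtain R' where R': "R' \<subseteq> R" "card R' = card Q"
    using assms(6) obtain_subset_with_card_n by metis
  have fin: "finite Q" "finite R'" using assms R' by (meson finite_subset)+
  obtain g1 where g1: "bij_betw g1 Q R'" using fin R'(2) by (metis finite_same_card_bij)
  have "card (A - Q) = card (B - R')" using assms R' fin by (simp add: card_Diff_subset)
  then obtain g2 where g2: "bij_betw g2 (A - Q) (B - R')"
    using assms by (metis finite_Diff finite_same_card_bij)
  have "bij_betw (\<lambda>x. if x \<in> Q then g1 x else g2 x) (Q \<union> (A - Q)) (R' \<union> (B - R'))"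
    by (rule bij_betw_disjoint_Un[OF g1 g2]) auto
  moreover have "Q \<union> (A - Q) = A" "R' \<union> (B - R') = B" using assms R' by auto
  ultimately show thesis
    using that[of "\<lambda>x. if x \<in> Q then g1 x else g2 x"] g1 R' by (auto simp: bij_betw_def)
qed

lemma bij_betw_respecting_point:
  assumes "finite A" "finite B" "card A = card B" "Q \<subseteq> A" "R \<subseteq> B" "card Q \<le> card R"
    and "v \<in> Q" "w \<in> R"
  obtains g where "bij_betw g A B" "g ` Q \<subseteq> R" "g v = w"
proof -
  have fin: "finite Q" "finite R" using assms by (meson finite_subset)+
  have vA: "v \<in> A" and wB: "w \<in> B" using assms by auto
  obtain g where g: "bij_betw g (A - {v}) (B - {w})" "g ` (Q - {v}) \<subseteq> R - {w}"
  proof (rule bij_betw_respecting[of "A - {v}" "B - {w}" "Q - {v}" "R - {w}"])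
    show "card (A - {v}) = card (B - {w})" using assms(3) vA wB by simp
    show "card (Q - {v}) \<le> card (R - {w})" using assms(6-8) fin by (simp add: diff_le_mono)
  qed (use assms in auto)
  have "bij_betw (g(v := w)) (insert v (A - {v})) (insert w (B - {w}))"
    using g(1) by (auto simp: bij_betw_def inj_on_def)
  moreover have "insert v (A - {v}) = A" "insert w (B - {w}) = B" using assms by auto
  ultimately show thesis using that[of "g(v := w)"] g(2) assms(7,8) by auto
qed

text \<open>The set \<open>q e\<close> holds the vertices of \<open>h e\<close> at which other edges may be attached; the list is
  built from its end.\<close>
fun treelike :: "('e \<Rightarrow> 'b set) \<Rightarrow> ('e \<Rightarrow> 'b set) \<Rightarrow> 'e list \<Rightarrow> bool" where
  "treelike h q [] = True"
| "treelike h q (e # es) \<longleftrightarrow> treelike h q es \<and>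
     (h e \<inter> (\<Union>e'\<in>set es. h e') = {} \<or>
      (\<exists>v. h e \<inter> (\<Union>e'\<in>set es. h e') = {v} \<and> v \<in> q e \<and> (\<exists>e'\<in>set es. v \<in> q e')))"

text \<open>Edges are placed greedily from the end of the list, each on fresh vertices apart from
  its attachment vertex. The invariant that \<open>q e\<close> is sent to attaching vertices of the
  image edge is what allows a later edge to be attached at any \<open>v \<in> q e\<close>. At most
  \<open>card Z + r * length es\<close> vertices are ever forbidden, hence the budget
  \<open>C\<close>.\<close>

lemma embed_treelike:
  assumes flex: "flexible r C P G" and "finite Z"
    and "\<And>e. e \<in> set es \<Longrightarrow> finite (h e) \<and> card (h e) = r \<and> q e \<subseteq> h e \<and> card (q e) \<le> 2"
    and "treelike h q es" and "card Z + r * length es \<le> C"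
  shows "\<exists>f. inj_on f (\<Union>e\<in>set es. h e) \<and> f ` (\<Union>e\<in>set es. h e) \<inter> Z = {} \<and>
           (\<forall>e\<in>set es. f ` h e \<in> P \<and> f ` q e \<subseteq> G (f ` h e))"
  using assms(3-5)
proof (induction es)
  case Nil
  then show ?case by simp
next
  case (Cons e es)
  let ?H = "\<Union>e\<in>set es. h e"
  have IH: "\<exists>f. inj_on f ?H \<and> f ` ?H \<inter> Z = {} \<and> (\<forall>e\<in>set es. f ` h e \<in> P \<and> f ` q e \<subseteq> G (f ` h e))"
    by (rule Cons.IH) (use Cons.prems in simp_all)
  obtain f where f: "inj_on f ?H" "f ` ?H \<inter> Z = {}"
      "\<And>e. e \<in> set es \<Longrightarrow> f ` h e \<in> P \<and> f ` q e \<subseteq> G (f ` h e)"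
    using IH by (elim exE conjE) blast
  have he: "finite (h e)" "card (h e) = r" "q e \<subseteq> h e" "card (q e) \<le> 2" using Cons.prems by auto
  have finH: "finite ?H" using Cons.prems(1) by auto
  have "card ?H \<le> (\<Sum>e\<in>set es. card (h e))" by (rule card_UN_le) simp
  also have "\<dots> = r * card (set es)" using Cons.prems(1) by simp
  also have "\<dots> \<le> r * length es" by (simp add: card_length)
  finally have cH: "card ?H \<le> r * length es" .
  define U where "U = Z \<union> f ` ?H"
  have finU: "finite U" using \<open>finite Z\<close> finH by (simp add: U_def)
  have "card U \<le> card Z + card (f ` ?H)" unfolding U_def by (rule card_Un_le)
  also have "\<dots> \<le> card Z + card ?H" using finH by (simp add: card_image_le)
  finally have cU: "card U \<le> C" using cH Cons.prems(3) by simp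
  have PD: "finite e'" "card e' = r" "G e' \<subseteq> e'" "2 \<le> card (G e')" if "e' \<in> P" for e'
    using that flex by (auto simp: flexible_def)
  \<comment> \<open>It suffices to place the new edge by some \<open>g\<close> that agrees with
    \<open>f\<close> on the overlap and avoids \<open>U\<close> elsewhere.\<close>
  have "\<exists>g. g ` h e \<in> P \<and> inj_on g (h e) \<and> g ` q e \<subseteq> G (g ` h e) \<and>
          (\<forall>x\<in>h e \<inter> ?H. g x = f x) \<and> g ` (h e - ?H) \<inter> U = {}"
  proof (cases "h e \<inter> ?H = {}")
    case True
    obtain e' where e': "e' \<in> P" "e' \<inter> U = {}" using flexible_avoid[OF flex finU cU] .
    obtain g where g: "bij_betw g (h e) e'" "g ` q e \<subseteq> G e'"
      by (rule bij_betw_respecting[of "h e" e' "q e" "G e'"]) (use he PD[OF e'(1)] in auto)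
    then have "g ` h e = e'" "inj_on g (h e)" by (auto simp: bij_betw_def)
    then show ?thesis using e' g True by (intro exI[of _ g]) auto
  next
    case False
    then obtain v e1 where v: "h e \<inter> ?H = {v}" "v \<in> q e" "e1 \<in> set es" "v \<in> q e1"
      using Cons.prems(2) by auto
    have fv: "f ` h e1 \<in> P" "f v \<in> G (f ` h e1)" using f(3)[OF v(3)] v(4) by auto
    \<comment> \<open>The point \<open>f v\<close> is occupied already, so it is exempted from the
      forbidden set; injectivity of \<open>g\<close> and \<open>g v = f v\<close> keep the other
      vertices of the new edge out of all of \<open>U\<close>.\<close>
    obtain e' where e': "e' \<in> P" "f v \<in> G e'" "e' \<inter> (U - {f v}) = {}"
      by (rule flexible_extend[OF flex fv, of "U - {f v}"])
        (use finU cU in \<open>auto intro: order.trans[OF card_Diff1_le]\<close>)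
    obtain g where g: "bij_betw g (h e) e'" "g ` q e \<subseteq> G e'" "g v = f v"
      by (rule bij_betw_respecting_point[of "h e" e' "q e" "G e'" v "f v"])
        (use he PD[OF e'(1)] v e' in auto)
    then have ge: "g ` h e = e'" "inj_on g (h e)" by (auto simp: bij_betw_def)
    have "g x \<notin> U" if "x \<in> h e - ?H" for x
    proof -
      have "x \<noteq> v" using that v by auto
      then have "g x \<noteq> f v" using ge(2) that v(1) g(3) by (metis DiffD1 IntD1 inj_onD insertI1)
      moreover have "g x \<in> e'" using ge that by auto
      ultimately show ?thesis using e'(3) by auto
    qed
    then show ?thesis using e' g v(1) ge by (intro exI[of _ g]) auto
  qed
  then obtain g where g': "g ` h e \<in> P \<and> inj_on g (h e) \<and> g ` q e \<subseteq> G (g ` h e) \<and>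
      (\<forall>x\<in>h e \<inter> ?H. g x = f x) \<and> g ` (h e - ?H) \<inter> U = {}" by (elim exE)
  have g: "g ` h e \<in> P" "inj_on g (h e)" "g ` q e \<subseteq> G (g ` h e)"
      and geq: "\<And>x. x \<in> h e \<Longrightarrow> x \<in> ?H \<Longrightarrow> g x = f x" and gU: "g ` (h e - ?H) \<inter> U = {}"
    using g' by (fast, fast, fast, fast, fast)
  define f' where "f' x = (if x \<in> ?H then f x else g x)" for x
  have im1: "f' ` A = f ` A" if "A \<subseteq> ?H" for A
    using that by (intro image_cong) (auto simp: f'_def)
  have im2: "f' ` A = g ` A" if "A \<subseteq> h e" for A
    using that by (intro image_cong refl) (metis f'_def geq subsetD)
  have split: "(\<Union>e\<in>set (e # es). h e) = ?H \<union> (h e - ?H)" by auto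
  have r1: "inj_on f' (?H \<union> (h e - ?H))"
  proof (subst inj_on_Un, intro conjI)
    show "inj_on f' ?H" using f(1) by (auto simp: inj_on_def f'_def)
    have "inj_on g (h e - ?H)" using g(2) by (rule inj_on_subset) auto
    then show "inj_on f' (h e - ?H)" by (subst inj_on_cong[of _ f' g]) (auto simp: f'_def)
    have "f' ` ?H \<subseteq> U" using im1[of ?H] by (auto simp: U_def)
    moreover have "f' ` (h e - ?H) \<inter> U = {}" using im2[of "h e - ?H"] gU by auto
    ultimately show "f' ` (?H - (h e - ?H)) \<inter> f' ` ((h e - ?H) - ?H) = {}" by blast
  qed
  have "g ` (h e - ?H) \<inter> Z = {}" using gU by (simp only: U_def Int_Un_distrib Un_empty)
  then have r2: "f' ` (?H \<union> (h e - ?H)) \<inter> Z = {}"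
    using f(2) by (simp only: image_Un im1[OF order.refl] im2[OF Diff_subset] Int_Un_distrib2 Un_empty_left)
  have r3: "f' ` h e' \<in> P \<and> f' ` q e' \<subseteq> G (f' ` h e')" if "e' \<in> set (e # es)" for e'
  proof (cases "e' \<in> set es")
    case True
    then have "h e' \<subseteq> ?H" by (rule UN_upper)
    moreover have "q e' \<subseteq> h e'" using Cons.prems(1)[of e'] True by simp
    ultimately have "f' ` h e' = f ` h e'" "f' ` q e' = f ` q e'"
      using im1[of "h e'"] im1[of "q e'"] by (simp_all only: order.trans)
    then show ?thesis using f(3)[OF True] by (simp only: simp_thms)
  next
    case False
    then have "e' = e" using that by simp
    then show ?thesis using g(1,3) by (simp only: im2[OF order.refl] im2[OF he(3)] simp_thms)
  qed
  show ?case unfolding split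
    by (rule exI[of _ f'], intro conjI ballI) (fact r1, fact r2, fact r3[THEN conjunct1], fact r3[THEN conjunct2])
qed

section \<open>Forests and expansions\<close>

lemma graph_finite_edges:
  assumes "graph V E"
  shows "finite E"
proof (rule finite_subset)
  show "E \<subseteq> Pow V" using assms by (fastforce simp: graph_def)
  show "finite (Pow V)" using assms by (simp add: graph_def)
qed

lemma graph_edge:
  assumes "graph V E" "e \<in> E"
  shows "e \<subseteq> V" "card e = 2" "finite e"
  using assms by (auto simp: graph_def dest!: bspec[of E _ e])

lemma forest_subset:
  assumes "forest V E" "E' \<subseteq> E"
  shows "forest V E'"
proof -
  have "graph V E'" using assms unfolding forest_def graph_def by blast
  moreover have "has_cycle V E" if "has_cycle V E'"
    using that assms(2) unfolding has_cycle_def by (meson subsetD)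
  ultimately show ?thesis using assms(1) unfolding forest_def by blast
qed

text \<open>The first edge of a longest path is a leaf edge.\<close>
lemma forest_leaf_edge:
  assumes "forest V E" "E \<noteq> {}"
  obtains e where "e \<in> E" "e \<inter> \<Union>(E - {e}) = {} \<or> (\<exists>v. e \<inter> \<Union>(E - {e}) = {v})"
proof -
  define path where "path vs \<longleftrightarrow> distinct vs \<and> set vs \<subseteq> V \<and> 2 \<le> length vs \<and>
    (\<forall>i. Suc i < length vs \<longrightarrow> {vs ! i, vs ! Suc i} \<in> E)" for vs
  have gr: "graph V E" and cyc: "\<not> has_cycle V E" using assms by (auto simp: forest_def)
  have finV: "finite V" using gr by (simp add: graph_def)
  obtain e0 where "e0 \<in> E" using assms(2) by blast
  then obtain x0 y0 where xy0: "x0 \<noteq> y0" "x0 \<in> V" "y0 \<in> V" "{x0, y0} \<in> E"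
    using gr unfolding graph_def by metis
  then have "path [x0, y0]" by (auto simp: path_def less_Suc_eq)
  moreover have "length vs < Suc (card V)" if "path vs" for vs
    using that finV unfolding path_def
    by (metis card_mono distinct_card le_imp_less_Suc)
  ultimately obtain vs where vs: "path vs" "\<And>ws. path ws \<Longrightarrow> length ws \<le> length vs"
    using ex_has_greatest_nat[of path "[x0, y0]" length "Suc (card V)"] by (metis less_imp_le)
  then obtain x y zs where vs_eq: "vs = x # y # zs"
    unfolding path_def by (metis Suc_le_length_iff numeral_2_eq_2)
  have e: "{x, y} \<in> E" using vs(1) vs_eq unfolding path_def by force
  \<comment> \<open>Another neighbour \<open>w\<close> of the end vertex \<open>x\<close> would
    prolong the longest path or, lying on it, close a cycle.\<close>
  have "x \<notin> e'" if e': "e' \<in> E" "e' \<noteq> {x, y}" for e'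
  proof
    assume "x \<in> e'"
    obtain a b where ab: "a \<noteq> b" "a \<in> V" "b \<in> V" "e' = {a, b}"
      using gr e'(1) unfolding graph_def by blast
    obtain w where w: "w \<noteq> x" "w \<in> V" "e' = {x, w}"
    proof (cases "a = x")
      case True
      then show ?thesis using ab by (intro that[of b]) auto
    next
      case False
      then show ?thesis using ab \<open>x \<in> e'\<close> by (intro that[of a]) auto
    qed
    then have "w \<noteq> y" using e'(2) by auto
    show False
    proof (cases "w \<in> set vs")
      case False
      have "path (w # vs)"
        unfolding path_def
      proof (intro conjI allI impI)
        fix i assume "Suc i < length (w # vs)"
        then show "{(w # vs) ! i, (w # vs) ! Suc i} \<in> E"
        proof (cases i)
          case 0
          then show ?thesis using w(3) e'(1) vs_eq by (simp add: insert_commute)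
        next
          case (Suc j)
          then show ?thesis using vs(1) \<open>Suc i < length (w # vs)\<close> by (simp add: path_def)
        qed
      qed (use vs(1) False w(2) in \<open>auto simp: path_def\<close>)
      then show False using vs(2)[of "w # vs"] by simp
    next
      case True
      then obtain j where j: "j < length vs" "vs ! j = w" by (meson in_set_conv_nth)
      have "vs ! 0 = x" "vs ! 1 = y" using vs_eq by simp_all
      then have "j \<noteq> 0" "j \<noteq> 1" using j(2) w(1) \<open>w \<noteq> y\<close> by metis+
      then have j2: "2 \<le> j" by simp
      \<comment> \<open>The initial segment from \<open>x\<close> to \<open>w\<close> has at least
        three vertices, and the edge \<open>{x, w}\<close> closes it.\<close>
      define cs where "cs = take (Suc j) vs"
      have len: "length cs = Suc j" using j(1) by (simp add: cs_def)
      have "{cs ! i, cs ! ((i + 1) mod length cs)} \<in> E" if "i < length cs" for i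
      proof (cases "i = j")
        case True
        then have "{cs ! i, cs ! ((i + 1) mod length cs)} = {w, x}"
          using len j \<open>vs ! 0 = x\<close> by (simp add: cs_def)
        then show ?thesis using w(3) e'(1) by (simp add: insert_commute)
      next
        case False
        then have "i < j" using that len by simp
        then have "{cs ! i, cs ! ((i + 1) mod length cs)} = {vs ! i, vs ! Suc i}"
          using len by (simp add: cs_def)
        then show ?thesis using vs(1) \<open>i < j\<close> j(1) by (simp add: path_def)
      qed
      moreover have "distinct cs" "set cs \<subseteq> V"
        using vs(1) set_take_subset[of "Suc j" vs] by (auto simp: cs_def path_def)
      ultimately have "has_cycle V E"
        unfolding has_cycle_def using len j2 by (intro exI[of _ cs]) simp
      then show False using cyc by simp
    qed
  qed
  then have "{x, y} \<inter> \<Union>(E - {{x, y}}) \<subseteq> {y}" by blast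
  then have "{x, y} \<inter> \<Union>(E - {{x, y}}) = {} \<or> {x, y} \<inter> \<Union>(E - {{x, y}}) = {y}" by blast
  then show thesis using that[OF e] by blast
qed

text \<open>Removing a leaf edge leaves a forest, so leaf edges can be peeled off one after another.
  The edge peeled first heads the list.\<close>

lemma forest_treelike:
  assumes "forest V E"
  obtains es where "set es = E" "distinct es" "treelike (\<lambda>e. e) (\<lambda>e. e) es"
proof -
  have "finite E" using assms graph_finite_edges by (auto simp: forest_def)
  then have "\<exists>es. set es = E \<and> distinct es \<and> treelike (\<lambda>e. e) (\<lambda>e. e) es"
    using assms
  proof (induction E rule: finite_psubset_induct)
    case (psubset E)
    show ?case
    proof (cases "E = {}")
      case True
      then show ?thesis by (intro exI[of _ "[]"]) simp
    next
      case False
      obtain e where e: "e \<in> E" "e \<inter> \<Union>(E - {e}) = {} \<or> (\<exists>v. e \<inter> \<Union>(E - {e}) = {v})"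
        using forest_leaf_edge[OF psubset.prems False] by blast
      obtain es where es: "set es = E - {e}" "distinct es" "treelike (\<lambda>e. e) (\<lambda>e. e) es"
        using psubset.IH[of "E - {e}"] e(1) forest_subset[OF psubset.prems, of "E - {e}"] by blast
      have "e \<inter> \<Union>(set es) = {} \<or> (\<exists>v. e \<inter> \<Union>(set es) = {v} \<and> v \<in> e \<and> (\<exists>e'\<in>set es. v \<in> e'))"
        using e(2) unfolding es(1) by (elim disjE exE) (rule disjI1, assumption, rule disjI2, blast)
      then have "treelike (\<lambda>e. e) (\<lambda>e. e) (e # es)"
        using es(3) by simp
      moreover have "set (e # es) = E" "distinct (e # es)" using es e(1) by auto
      ultimately show ?thesis by blast
    qed
  qed
  then show thesis using that by blast
qed

section \<open>Expansions of forests as treelike hypergraphs\<close>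

definition expand :: "nat \<Rightarrow> 'a set \<Rightarrow> ('a + 'a set \<times> nat) set" where
  "expand k e = Inl ` e \<union> {Inr (e, i) | i. i < k - 2}"

lemma expansion_edges_eq: "expansion_edges k V E = expand k ` E"
  by (simp add: expansion_edges_def expand_def)

lemma finite_expand: "finite e \<Longrightarrow> finite (expand k e)"
  by (simp add: expand_def)

lemma card_expand:
  assumes "card e = 2" "k \<ge> 2"
  shows "card (expand k e) = k"
proof -
  have fin: "finite e" using assms(1) by (metis card.infinite zero_neq_numeral)
  have eq: "{Inr (e, i) | i. i < k - 2} = (\<lambda>i. Inr (e, i) :: 'a + 'a set \<times> nat) ` {..<k - 2}" by auto
  have "card (expand k e) = card (Inl ` e :: ('a + 'a set \<times> nat) set) +
          card ((\<lambda>i. Inr (e, i) :: 'a + 'a set \<times> nat) ` {..<k - 2})"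
    unfolding expand_def eq using fin by (intro card_Un_disjoint) auto
  also have "\<dots> = 2 + (k - 2)" using assms(1) by (simp add: card_image inj_on_def)
  finally show ?thesis using assms(2) by simp
qed

lemma expand_subset_vertices:
  assumes "graph V E" "e \<in> E"
  shows "expand k e \<subseteq> expansion_vertices k V E"
  using graph_edge(1)[OF assms] assms(2) by (auto simp: expand_def expansion_vertices_def)

lemma finite_expansion_vertices:
  assumes "graph V E"
  shows "finite (expansion_vertices k V E)"
proof -
  have "{Inr (e, i) | e i. e \<in> E \<and> i < k - 2} = (Inr ` (E \<times> {..<k - 2}) :: ('a + 'a set \<times> nat) set)"
    by auto
  then show ?thesis using assms graph_finite_edges[OF assms]
    by (simp add: expansion_vertices_def graph_def)
qed

text \<open>New vertices carry the label of their edge, so distinct expanded edges overlap only in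
  original vertices, exactly as in the forest. Deleting \<open>K\<close> can at most remove the
  attachment vertex, and then the edge just becomes disjoint from the rest of the list.\<close>

lemma treelike_expand:
  assumes "distinct es" "treelike (\<lambda>e. e) (\<lambda>e. e) es"
  shows "treelike (\<lambda>e. expand k e - K) (\<lambda>e. Inl ` e - K) es"
  using assms
proof (induction es)
  case (Cons e es)
  let ?I = "(expand k e - K) \<inter> (\<Union>e'\<in>set es. expand k e' - K)"
  have I: "?I = Inl ` (e \<inter> \<Union>(set es)) - K"
    using Cons.prems(1) by (auto simp: expand_def)
  consider "e \<inter> \<Union>(set es) = {}" | v where "e \<inter> \<Union>(set es) = {v}"
    using Cons.prems(2) by auto
  then have "?I = {} \<or> (\<exists>v. ?I = {v} \<and> v \<in> Inl ` e - K \<and> (\<exists>e'\<in>set es. v \<in> Inl ` e' - K))"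
  proof cases
    case 1
    then show ?thesis unfolding I by simp
  next
    case (2 v)
    show ?thesis
    proof (cases "Inl v \<in> K")
      case True
      then show ?thesis unfolding I 2 by simp
    next
      case False
      moreover have "v \<in> e" "\<exists>e'\<in>set es. v \<in> e'" using 2 by blast+
      ultimately show ?thesis unfolding I 2 by (intro disjI2 exI[of _ "Inl v"]) auto
    qed
  qed
  then show ?case using Cons by simp
qed simp

text \<open>Only the traces of the edges outside \<open>K\<close> are embedded greedily, with
  \<open>Z\<close> kept free so that any bijection can send \<open>K\<close> there. With
  \<open>K\<close> empty this embeds the expansion itself; with \<open>K\<close> a crosscut it
  embeds the traces into a link.\<close>

lemma embed_expansion:
  fixes L :: "nat set set"
  assumes "forest V E" and flex: "flexible r C L G"
    and K: "K \<subseteq> expansion_vertices k V E" and Z: "finite Z" "card Z = card K"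
    and r: "\<And>e. e \<in> E \<Longrightarrow> card (expand k e - K) = r" and "card Z + r * card E \<le> C"
  obtains f where "inj_on f (expansion_vertices k V E)" "f ` K = Z"
    "\<And>e. e \<in> E \<Longrightarrow> f ` (expand k e - K) \<in> L"
proof -
  let ?W = "expansion_vertices k V E"
  have gr: "graph V E" using assms(1) by (simp add: forest_def)
  have finW: "finite ?W" by (rule finite_expansion_vertices) fact
  then have finK: "finite K" using K finite_subset by blast
  obtain es where es: "set es = E" "distinct es" "treelike (\<lambda>e. e) (\<lambda>e. e) es"
    using forest_treelike[OF assms(1)] by blast
  define A where "A = (\<Union>e\<in>E. expand k e - K)"
  have len: "length es = card E" using es by (metis distinct_card)
  have "\<exists>f. inj_on f (\<Union>e\<in>set es. expand k e - K) \<and> f ` (\<Union>e\<in>set es. expand k e - K) \<inter> Z = {} \<and>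
           (\<forall>e\<in>set es. f ` (expand k e - K) \<in> L \<and> f ` (Inl ` e - K) \<subseteq> G (f ` (expand k e - K)))"
  proof (rule embed_treelike[OF flex Z(1)])
    fix e assume "e \<in> set es"
    then have e: "e \<in> E" using es by simp
    have "card (Inl ` e - K) \<le> card (Inl ` e :: ('a + 'a set \<times> nat) set)"
      using graph_edge(3)[OF gr e] by (intro card_mono) auto
    also have "\<dots> = 2" using graph_edge(2)[OF gr e] by (simp add: card_image)
    finally show "finite (expand k e - K) \<and> card (expand k e - K) = r \<and>
        Inl ` e - K \<subseteq> expand k e - K \<and> card (Inl ` e - K) \<le> 2"
      using r[OF e] finite_expand[OF graph_edge(3)[OF gr e]] by (auto simp: expand_def)
  next
    show "treelike (\<lambda>e. expand k e - K) (\<lambda>e. Inl ` e - K) es"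
      by (rule treelike_expand) fact+
  qed (use assms(7) len in simp)
  then obtain f0 where f0: "inj_on f0 A" "f0 ` A \<inter> Z = {}"
      "\<And>e. e \<in> E \<Longrightarrow> f0 ` (expand k e - K) \<in> L"
    unfolding es A_def by (elim exE conjE) simp
  have AW: "A \<subseteq> ?W - K" unfolding A_def using expand_subset_vertices[OF gr] by blast
  then have finA: "finite A" using finW finite_subset by blast
  obtain g where g: "bij_betw g K Z" using finK Z by (metis finite_same_card_bij)
  define R where "R = ?W - (A \<union> K)"
  have finR: "finite R" using finW by (simp add: R_def)
  have "infinite (UNIV - (f0 ` A \<union> Z))" using finA Z(1) by (simp add: Diff_infinite_finite)
  then obtain R' where R': "finite R'" "card R' = card R" "R' \<subseteq> UNIV - (f0 ` A \<union> Z)"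
    using infinite_arbitrarily_large by metis
  then obtain h where h: "bij_betw h R R'" using finR by (metis finite_same_card_bij)
  have "bij_betw f0 A (f0 ` A)" using f0(1) by (rule inj_on_imp_bij_betw)
  then have 1: "bij_betw (\<lambda>x. if x \<in> A then f0 x else g x) (A \<union> K) (f0 ` A \<union> Z)"
    using g AW f0(2) by (intro bij_betw_disjoint_Un) auto
  define f where "f x = (if x \<in> A \<union> K then (if x \<in> A then f0 x else g x) else h x)" for x
  have "bij_betw f ((A \<union> K) \<union> R) ((f0 ` A \<union> Z) \<union> R')"
    unfolding f_def using R'(3) by (intro bij_betw_disjoint_Un[OF 1 h]) (auto simp: R_def)
  moreover have "(A \<union> K) \<union> R = ?W" using AW K by (auto simp: R_def)
  ultimately have inj: "inj_on f ?W" by (simp add: bij_betw_def)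
  have "f ` K = g ` K" using AW by (intro image_cong refl) (auto simp: f_def)
  then have fK: "f ` K = Z" using g by (simp add: bij_betw_def)
  have "f ` (expand k e - K) \<in> L" if "e \<in> E" for e
  proof -
    have "f ` (expand k e - K) = f0 ` (expand k e - K)"
      using that by (intro image_cong refl) (auto simp: f_def A_def)
    then show ?thesis using f0(3)[OF that] by simp
  qed
  then show thesis using that[OF inj fK] by blast
qed

lemma contains_copy_if_flexible:
  assumes "forest V E" "k \<ge> 2" "flexible k C P G" "P \<subseteq> F" "k * card E \<le> C"
  shows "contains_copy F (expansion_vertices k V E) (expansion_edges k V E)"
proof -
  have gr: "graph V E" using assms(1) by (simp add: forest_def)
  obtain f where f: "inj_on f (expansion_vertices k V E)"
      "\<And>e. e \<in> E \<Longrightarrow> f ` (expand k e - {}) \<in> P"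
    by (rule embed_expansion[OF assms(1,3), of "{}" k "{}"])
      (use card_expand[OF graph_edge(2)[OF gr] assms(2)] assms(5) in auto)
  then show ?thesis
    unfolding contains_copy_def expansion_edges_eq using assms(4) by (intro exI[of _ f]) auto
qed

section \<open>Crosscuts and embeddings through a common link\<close>

text \<open>Take an optimal \<open>X\<close> from \<open>sigma\<close> together with one new vertex,
  that of index \<open>0\<close>, of every edge missed by \<open>X\<close>. Independence prevents
  \<open>X\<close> from meeting an edge twice, and \<open>k \<ge> 3\<close> provides the new
  vertex.\<close>

lemma sigma_crosscut:
  assumes "graph V E" "k \<ge> 3"
  obtains K where "K \<subseteq> expansion_vertices k V E" "card K = sigma V E"
    "\<And>e. e \<in> E \<Longrightarrow> \<exists>w. expand k e \<inter> K = {w}"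
proof -
  have finV: "finite V" using assms(1) by (simp add: graph_def)
  let ?cost = "\<lambda>X. card X + card {e\<in>E. e \<inter> X = {}}"
  have "finite {X. independent V E X}" using finV by (simp add: independent_def)
  moreover have "independent V E {}" unfolding independent_def using graph_edge(2)[OF assms(1)] by fastforce
  ultimately have "Min (?cost ` {X. independent V E X}) \<in> ?cost ` {X. independent V E X}"
    by (intro Min_in) auto
  then obtain X where X: "independent V E X" "sigma V E = ?cost X"
    by (auto simp: sigma_def)
  define M where "M = {e\<in>E. e \<inter> X = {}}"
  define K :: "('a + 'a set \<times> nat) set" where "K = Inl ` X \<union> (\<lambda>e. Inr (e, 0)) ` M"
  have finX: "finite X" and XV: "X \<subseteq> V"
    using X(1) finV by (auto simp: independent_def intro: finite_subset)
  have finM: "finite M" using graph_finite_edges[OF assms(1)] by (simp add: M_def)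
  have "card K = card (Inl ` X :: ('a + 'a set \<times> nat) set) +
      card ((\<lambda>e. Inr (e, 0)) ` M :: ('a + 'a set \<times> nat) set)"
    unfolding K_def using finX finM by (intro card_Un_disjoint) auto
  also have "\<dots> = sigma V E"
    unfolding X(2) M_def[symmetric] by (simp add: card_image inj_on_def)
  finally have cK: "card K = sigma V E" .
  have "K \<subseteq> expansion_vertices k V E"
    using XV assms(2) by (auto simp: K_def M_def expansion_vertices_def)
  moreover have "\<exists>w. expand k e \<inter> K = {w}" if e: "e \<in> E" for e
  proof (cases "e \<in> M")
    case True
    then have "expand k e \<inter> K = {Inr (e, 0)}"
      using assms(2) by (auto simp: expand_def K_def M_def)
    then show ?thesis by blast
  next
    case False
    obtain x y where xy: "x \<noteq> y" "e = {x, y}" using assms(1) e by (auto simp: graph_def)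
    have "\<not> e \<subseteq> X" using X(1) e by (simp add: independent_def)
    moreover have "e \<inter> X \<noteq> {}" using False e by (simp add: M_def)
    ultimately obtain z where "e \<inter> X = {z}" using xy by auto
    moreover have "expand k e \<inter> K = Inl ` (e \<inter> X)"
      using False by (auto simp: expand_def K_def)
    ultimately have "expand k e \<inter> K = {Inl z}" by simp
    then show ?thesis by blast
  qed
  ultimately show thesis using that cK by blast
qed

text \<open>Send a crosscut to \<open>Z\<close>; each expanded edge loses one vertex and becomes a
  \<open>(k - 1)\<close>-set to be placed in \<open>L\<close>. Every \<open>z \<in> Z\<close>
  completes every \<open>S \<in> L\<close>, so any bijection from the crosscut to \<open>Z\<close>
  works.\<close>

lemma contains_copy_if_flexible_link:
  assumes "forest V E" "k \<ge> 3" "flexible (k - 1) C L G" "finite Z" "card Z = sigma V E"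
    and "\<And>S z. S \<in> L \<Longrightarrow> z \<in> Z \<Longrightarrow> insert z S \<in> F"
    and "sigma V E + (k - 1) * card E \<le> C"
  shows "contains_copy F (expansion_vertices k V E) (expansion_edges k V E)"
proof -
  have gr: "graph V E" using assms(1) by (simp add: forest_def)
  obtain K where K: "K \<subseteq> expansion_vertices k V E" "card K = sigma V E"
      "\<And>e. e \<in> E \<Longrightarrow> \<exists>w. expand k e \<inter> K = {w}"
    using sigma_crosscut[OF gr assms(2)] by blast
  have cK: "card (expand k e - K) = k - 1" if e: "e \<in> E" for e
  proof -
    obtain w where w: "expand k e \<inter> K = {w}" using K(3)[OF e] by blast
    then have "expand k e - K = expand k e - {w}" "w \<in> expand k e" by auto
    moreover have "card (expand k e) = k"
      using card_expand[OF graph_edge(2)[OF gr e]] assms(2) by simp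
    ultimately show ?thesis by simp
  qed
  obtain f where f: "inj_on f (expansion_vertices k V E)" "f ` K = Z"
      "\<And>e. e \<in> E \<Longrightarrow> f ` (expand k e - K) \<in> L"
    by (rule embed_expansion[OF assms(1,3) K(1) assms(4)]) (use cK assms(5,7) K(2) in simp_all)
  have "f ` expand k e \<in> F" if e: "e \<in> E" for e
  proof -
    obtain w where w: "expand k e \<inter> K = {w}" using K(3)[OF e] by blast
    then have eq: "expand k e = insert w (expand k e - K)" by blast
    have "f w \<in> Z" using w f(2) by blast
    then have "insert (f w) (f ` (expand k e - K)) \<in> F" using f(3)[OF e] assms(6) by blast
    then show ?thesis by (simp only: image_insert[symmetric] eq[symmetric])
  qed
  then show ?thesis
    unfolding contains_copy_def expansion_edges_eq using f(1) by (intro exI[of _ f]) auto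
qed

section \<open>Upper bound\<close>

lemma card_supersets_le:
  assumes "finite A" "card A \<le> j"
  shows "card {S. S \<subseteq> {..<n} \<and> card S = j \<and> A \<subseteq> S} \<le> n ^ (j - card A)"
proof -
  let ?X = "{S. S \<subseteq> {..<n} \<and> card S = j \<and> A \<subseteq> S}"
  let ?Y = "{B. B \<subseteq> {..<n} \<and> card B = j - card A}"
  have "inj_on (\<lambda>S. S - A) ?X" by (rule inj_onI) blast
  moreover have "(\<lambda>S. S - A) ` ?X \<subseteq> ?Y" using assms(1) by (auto simp: card_Diff_subset)
  moreover have "finite ?Y" by simp
  ultimately have "card ?X \<le> card ?Y" by (rule card_inj_on_le)
  also have "\<dots> = n choose (j - card A)" using n_subsets[of "{..<n}" "j - card A"] by simp
  also have "\<dots> \<le> n ^ (j - card A)"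
    by (cases "j - card A \<le> n") (simp_all add: binomial_le_pow binomial_eq_0)
  finally show ?thesis .
qed

text \<open>A set \<open>U\<close> of at most \<open>C\<close> vertices blocks at most
  \<open>C * b\<close> of the edges to be attached at \<open>x\<close>, fewer than there
  are.\<close>

lemma flexible_if_degrees:
  assumes "finite P" "P \<noteq> {}"
    and "\<And>e. e \<in> P \<Longrightarrow> finite e \<and> card e = r \<and> G e \<subseteq> e \<and> 2 \<le> card (G e)"
    and deg: "\<And>e x. e \<in> P \<Longrightarrow> x \<in> G e \<Longrightarrow> C * b < card {e'\<in>P. x \<in> G e'}"
    and codeg: "\<And>x u. x \<noteq> u \<Longrightarrow> card {e\<in>P. x \<in> G e \<and> u \<in> e} \<le> b"
  shows "flexible r C P G"
proof -
  have ext: "\<exists>e\<in>P. x \<in> G e \<and> e \<inter> U = {}"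
    if "e0 \<in> P" "x \<in> G e0" "finite U" "card U \<le> C" "x \<notin> U" for e0 x U
  proof (rule ccontr)
    assume "\<not> ?thesis"
    then have "{e\<in>P. x \<in> G e} \<subseteq> (\<Union>u\<in>U. {e\<in>P. x \<in> G e \<and> u \<in> e})" by blast
    then have "card {e\<in>P. x \<in> G e} \<le> card (\<Union>u\<in>U. {e\<in>P. x \<in> G e \<and> u \<in> e})"
      using \<open>finite P\<close> \<open>finite U\<close> by (intro card_mono) auto
    also have "\<dots> \<le> (\<Sum>u\<in>U. card {e\<in>P. x \<in> G e \<and> u \<in> e})" by (rule card_UN_le) fact
    also have "\<dots> \<le> (\<Sum>u\<in>U. b)" using codeg that(5) by (intro sum_mono) metis
    also have "\<dots> \<le> C * b" using that(4) by simp
    finally show False using deg[OF that(1,2)] by simp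
  qed
  show ?thesis
    unfolding flexible_def
  proof (intro conjI ballI allI impI)
    fix x U assume "x \<in> \<Union> (G ` P)" "finite U" "card U \<le> C" "x \<notin> U"
    then show "\<exists>e\<in>P. x \<in> G e \<and> e \<inter> U = {}" using ext by (elim UN_E)
  qed (use assms(2,3) in simp_all)
qed

text \<open>Peeling at the threshold \<open>C * n ^ (r - 2)\<close> loses at most
  \<open>C * n ^ (r - 1)\<close> sets, and degrees among the survivors exceed \<open>C\<close> times
  the trivial codegree bound \<open>n ^ (r - 2)\<close>.\<close>

lemma flexible_subfamily:
  assumes "L \<subseteq> {S. S \<subseteq> {..<n} \<and> card S = r}" "r \<ge> 2" "C * n ^ (r - 1) < card L"
  obtains P where "P \<subseteq> L" "flexible r C P (\<lambda>S. S)"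
proof -
  have finL: "finite L" using assms(1) by (rule finite_subset) simp
  have "r - 1 = Suc (r - 2)" using assms(2) by simp
  then have large: "card {..<n} * (C * n ^ (r - 2)) < card L" using assms(3) by (simp add: mult.left_commute)
  obtain P where P: "P \<subseteq> L" "P \<noteq> {}"
      "\<And>S x. S \<in> P \<Longrightarrow> x \<in> S \<Longrightarrow> C * n ^ (r - 2) < card {S'\<in>P. x \<in> S'}"
    by (rule dense_subfamily[OF finL _ _ large, where G = "\<lambda>S. S"]) (use assms(1) in auto)
  have "flexible r C P (\<lambda>S. S)"
  proof (rule flexible_if_degrees[where b = "n ^ (r - 2)"])
    show "finite P" using P(1) finL by (rule finite_subset)
  next
    fix S assume "S \<in> P"
    then have "S \<subseteq> {..<n}" "card S = r" using P(1) assms(1) by auto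
    then show "finite S \<and> card S = r \<and> S \<subseteq> S \<and> 2 \<le> card S"
      using assms(2) finite_subset by blast
  next
    fix x u :: nat assume "x \<noteq> u"
    have "card {S\<in>P. x \<in> S \<and> u \<in> S} \<le> card {S. S \<subseteq> {..<n} \<and> card S = r \<and> {x, u} \<subseteq> S}"
      using P(1) assms(1) by (intro card_mono) auto
    also have "\<dots> \<le> n ^ (r - card {x, u})"
      using \<open>x \<noteq> u\<close> assms(2) by (intro card_supersets_le) auto
    finally show "card {S\<in>P. x \<in> S \<and> u \<in> S} \<le> n ^ (r - 2)" using \<open>x \<noteq> u\<close> by (simp add: numeral_2_eq_2)
  qed (use P in simp_all)
  then show thesis using that P(1) by blast
qed

text \<open>Exchanging, one at a time, the vertices of an edge that lie in \<open>U\<close> stays inside \<open>Q\<close>.\<close>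
lemma flexible_if_full:
  assumes "finite Q" "Q \<noteq> {}" "k \<ge> 2" "\<And>e. e \<in> Q \<Longrightarrow> finite e \<and> card e = k"
    and full: "\<And>e S. e \<in> Q \<Longrightarrow> S \<subseteq> e \<Longrightarrow> card S = k - 1 \<Longrightarrow> C < card {e'\<in>Q. S \<subseteq> e'}"
  shows "flexible k C Q (\<lambda>e. e)"
proof -
  have ext: "\<exists>e\<in>Q. x \<in> e \<and> e \<inter> U = {}"
    if e0: "e0 \<in> Q" "x \<in> e0" and U: "finite U" "card U \<le> C" "x \<notin> U" for e0 x U
  proof -
    obtain e where e: "e \<in> Q" "x \<in> e"
        and least: "\<And>e'. e' \<in> Q \<Longrightarrow> x \<in> e' \<Longrightarrow> card (e \<inter> U) \<le> card (e' \<inter> U)"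
      using ex_has_least_nat[of "\<lambda>e. e \<in> Q \<and> x \<in> e" e0 "\<lambda>e. card (e \<inter> U)"] e0 by blast
    have "e \<inter> U = {}"
    proof (rule ccontr)
      assume "e \<inter> U \<noteq> {}"
      then obtain u where u: "u \<in> e" "u \<in> U" by blast
      define S where "S = e - {u}"
      have ek: "finite e" "card e = k" using assms(4)[OF e(1)] by auto
      have S: "S \<subseteq> e" "card S = k - 1" "finite S" using u ek by (auto simp: S_def)
      \<comment> \<open>More than \<open>C\<close> edges of \<open>Q\<close> contain
        \<open>S\<close>, and at most \<open>card U \<le> C\<close> of them add a vertex of
        \<open>U\<close> to it.\<close>
      have "\<not> {e'\<in>Q. S \<subseteq> e'} \<subseteq> (\<lambda>v. insert v S) ` U"
      proof
        assume "{e'\<in>Q. S \<subseteq> e'} \<subseteq> (\<lambda>v. insert v S) ` U"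
        then have "card {e'\<in>Q. S \<subseteq> e'} \<le> card U" using U(1) by (rule surj_card_le[rotated])
        then show False using full[OF e(1) S(1,2)] U(2) by simp
      qed
      then obtain e' where e': "e' \<in> Q" "S \<subseteq> e'" "e' \<notin> (\<lambda>v. insert v S) ` U" by blast
      have "finite e'" "card e' = k" using assms(4)[OF e'(1)] by auto
      then have "card (e' - S) = 1" using S e'(2) assms(3) by (simp add: card_Diff_subset)
      then obtain v where v: "e' - S = {v}" by (rule card_1_singletonE)
      then have "e' = insert v S" using e'(2) by blast
      then have "v \<notin> U" using e'(3) by blast
      then have "e' \<inter> U = e \<inter> U - {u}" using \<open>e' = insert v S\<close> by (auto simp: S_def)
      then have "e' \<inter> U \<subset> e \<inter> U" using u by blast
      then have "card (e' \<inter> U) < card (e \<inter> U)" using ek(1) by (simp add: psubset_card_mono)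
      moreover have "x \<in> e'" using e(2) u(2) U(3) e'(2) by (auto simp: S_def)
      ultimately show False using least[OF e'(1)] by simp
    qed
    then show ?thesis using e by blast
  qed
  show ?thesis
    unfolding flexible_def
  proof (intro conjI ballI allI impI)
    fix x U assume "x \<in> \<Union> ((\<lambda>e. e) ` Q)" "finite U" "card U \<le> C" "x \<notin> U"
    then show "\<exists>e\<in>Q. x \<in> e \<and> e \<inter> U = {}" using ext by (elim UN_E)
  qed (use assms(2-4) in simp_all)
qed

section \<open>Edges with popular centres\<close>

text \<open>Count pairs of an \<open>r\<close>-set \<open>S\<close> and a centre
  \<open>z \<in> B\<close> with \<open>insert z S \<in> F\<close>. Sets with fewer than
  \<open>s\<close> centres contribute at most \<open>s - 1\<close> each and the others at most
  \<open>b\<close>, so the excess over \<open>(s - 1) * (n choose r)\<close> forces many sets with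
  \<open>s\<close> centres. Pigeonhole over the at most \<open>2 ^ b\<close> subsets of
  \<open>B\<close> gives many with the same \<open>Z\<close>.\<close>

lemma common_link:
  assumes "finite B" "card B = b"
    and F2: "\<And>e. e \<in> F2 \<Longrightarrow> e \<in> F \<and> c e \<subseteq> {..<n} \<and> card (c e) = r \<and> a e \<in> B \<and> a e \<notin> c e \<and>
              e = insert (a e) (c e)"
    and large: "(s - 1) * (n choose r) + b * (2 ^ b * M) < card F2"
  obtains Z where "Z \<subseteq> B" "card Z = s"
    "M < card {S. S \<subseteq> {..<n} \<and> card S = r \<and> (\<forall>z\<in>Z. insert z S \<in> F)}"
proof -
  define SS where "SS = {S. S \<subseteq> {..<n} \<and> card S = r}"
  define cen where "cen S = {z\<in>B. insert z S \<in> F}" for S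
  have finSS: "finite SS" by (simp add: SS_def)
  have cSS: "card SS = n choose r" using n_subsets[of "{..<n}" r] by (simp add: SS_def)
  have cen: "cen S \<subseteq> B" "finite (cen S)" "card (cen S) \<le> b" for S
    using assms(1,2) by (auto simp: cen_def intro: card_mono)
  have "inj_on (\<lambda>e. (c e, a e)) F2"
  proof (rule inj_onI)
    fix e e' assume "e \<in> F2" "e' \<in> F2" "(c e, a e) = (c e', a e')"
    moreover from this have "e = insert (a e) (c e)" "e' = insert (a e') (c e')" using F2 by blast+
    ultimately show "e = e'" by simp
  qed
  moreover have "(\<lambda>e. (c e, a e)) ` F2 \<subseteq> Sigma SS cen"
  proof
    fix p assume "p \<in> (\<lambda>e. (c e, a e)) ` F2"
    then obtain e where e: "e \<in> F2" "p = (c e, a e)" by blast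
    have "c e \<in> SS" "a e \<in> B" "insert (a e) (c e) \<in> F" using F2[OF e(1)] by (auto simp: SS_def)
    then show "p \<in> Sigma SS cen" using e(2) by (simp add: cen_def)
  qed
  moreover have "finite (Sigma SS cen)" using finSS cen(2) by blast
  ultimately have "card F2 \<le> card (Sigma SS cen)" by (rule card_inj_on_le)
  also have "\<dots> = (\<Sum>S\<in>SS. card (cen S))" using finSS cen(2) by simp
  also have "\<dots> \<le> (\<Sum>S\<in>SS. (s - 1) + (if s \<le> card (cen S) then b else 0))"
    using cen(3) by (intro sum_mono) (auto intro: trans_le_add2)
  also have "\<dots> = (s - 1) * (n choose r) + b * card {S\<in>SS. s \<le> card (cen S)}"
    using finSS cSS by (simp add: sum.distrib sum.If_cases Int_def mult.commute)
  finally have 1: "card F2 \<le> (s - 1) * (n choose r) + b * card {S\<in>SS. s \<le> card (cen S)}" .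
  have "\<exists>Z. Z \<subseteq> B \<and> card Z = s \<and> M < card {S\<in>SS. Z \<subseteq> cen S}"
  proof (rule ccontr)
    assume "\<not> ?thesis"
    then have le: "card {S\<in>SS. Z \<subseteq> cen S} \<le> M" if "Z \<in> Pow B" "card Z = s" for Z
      using \<open>\<not> (\<exists>Z. Z \<subseteq> B \<and> card Z = s \<and> M < card {S\<in>SS. Z \<subseteq> cen S})\<close> that
      by (simp only: not_le[symmetric] Pow_iff) blast
    let ?ZZ = "{Z \<in> Pow B. card Z = s}"
    have finZ: "finite ?ZZ" using assms(1) by simp
    have "{S\<in>SS. s \<le> card (cen S)} \<subseteq> (\<Union>Z\<in>?ZZ. {S\<in>SS. Z \<subseteq> cen S})"
    proof
      fix S assume "S \<in> {S\<in>SS. s \<le> card (cen S)}"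
      then have S: "S \<in> SS" "s \<le> card (cen S)" by auto
      from S(2) obtain Z where "Z \<subseteq> cen S" "card Z = s" using obtain_subset_with_card_n by metis
      then show "S \<in> (\<Union>Z\<in>?ZZ. {S\<in>SS. Z \<subseteq> cen S})" using S(1) cen(1) by blast
    qed
    then have "card {S\<in>SS. s \<le> card (cen S)} \<le> card (\<Union>Z\<in>?ZZ. {S\<in>SS. Z \<subseteq> cen S})"
      using finZ finSS by (intro card_mono) auto
    also have "\<dots> \<le> (\<Sum>Z\<in>?ZZ. card {S\<in>SS. Z \<subseteq> cen S})" by (rule card_UN_le) fact
    also have "\<dots> \<le> (\<Sum>Z\<in>?ZZ. M)" using le by (intro sum_mono) simp
    also have "\<dots> = card ?ZZ * M" by simp
    also have "\<dots> \<le> card (Pow B) * M" using assms(1) by (intro mult_right_mono card_mono) auto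
    also have "\<dots> = 2 ^ b * M" using assms(1,2) by (simp add: card_Pow)
    finally have "b * card {S\<in>SS. s \<le> card (cen S)} \<le> b * (2 ^ b * M)" by (rule mult_left_mono) simp
    then show False using 1 large by linarith
  qed
  then obtain Z where Z: "Z \<subseteq> B" "card Z = s" "M < card {S\<in>SS. Z \<subseteq> cen S}" by blast
  have "{S\<in>SS. Z \<subseteq> cen S} = {S. S \<subseteq> {..<n} \<and> card S = r \<and> (\<forall>z\<in>Z. insert z S \<in> F)}"
    using Z(1) by (auto simp: SS_def cen_def)
  then show thesis using that Z by simp
qed

section \<open>Edges with scattered centres\<close>

lemma card_fibres_le:
  assumes "finite SS" "\<And>e. e \<in> F \<Longrightarrow> c e \<in> SS" "\<And>S. card {e\<in>F. c e = S} \<le> D" "finite F"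
  shows "card F \<le> D * card SS"
proof -
  have "F \<subseteq> (\<Union>S\<in>SS. {e\<in>F. c e = S})" using assms(2) by blast
  then have "card F \<le> card (\<Union>S\<in>SS. {e\<in>F. c e = S})" using assms(1,4) by (intro card_mono) auto
  also have "\<dots> \<le> (\<Sum>S\<in>SS. card {e\<in>F. c e = S})" by (rule card_UN_le) fact
  also have "\<dots> \<le> (\<Sum>S\<in>SS. D)" using assms(3) by (intro sum_mono)
  finally show ?thesis by (simp add: mult.commute)
qed

text \<open>A vertex \<open>x\<close> is bad for a centre \<open>z\<close> if more than \<open>t\<close> edges with centre \<open>z\<close> contain it. Both
  the number of bad vertices of a single centre and the total number of bad pairs are small, hence
  so is the sum of the squares that bounds the number of edges with two bad vertices.\<close>
lemma flexible_if_scattered_centres: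
  fixes n k C D t q :: nat
  assumes finF: "finite F" and k: "k \<ge> 4"
    and F: "\<And>e. e \<in> F \<Longrightarrow> c e \<subseteq> {..<n} \<and> card (c e) = k - 1 \<and> a e < n \<and> a e \<notin> c e \<and> e = insert (a e) (c e)"
    and fib: "\<And>S. card {e\<in>F. c e = S} \<le> D"
    and small: "\<And>z. card {e\<in>F. a e = z} \<le> q"
    and large: "t\<^sup>2 * (n * (C * (D * n ^ (k - 3) + t))) + (k - 1)\<^sup>2 * q * D * n ^ (k - 1) * n ^ (k - 3)
                  < t\<^sup>2 * card F"
  obtains P G where "P \<subseteq> F" "flexible k C P G"
proof -
  define d where "d z x = card {e\<in>F. a e = z \<and> x \<in> c e}" for z x
  define bad where "bad z = {x\<in>{..<n}. t < d z x}" for z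
  define good where "good e = {x\<in>c e. d (a e) x \<le> t}" for e
  define Fb where "Fb = {e\<in>F. 2 \<le> card (c e \<inter> bad (a e))}"
  \<comment> \<open>Codegree bound: if \<open>x\<close> is good for \<open>e\<close> and
    \<open>u \<in> e\<close> is another vertex, then either both lie in \<open>c e\<close>, or
    \<open>u\<close> is the centre and goodness of \<open>x\<close> leaves at most \<open>t\<close>
    such edges.\<close>
  define b where "b = D * n ^ (k - 3) + t"
  have finbad: "finite (bad z)" for z by (simp add: bad_def)
  have finc: "finite (c e)" if "e \<in> F" for e using F[OF that] finite_subset by blast
  have above: "card {S. S \<subseteq> {..<n} \<and> card S = k - 1 \<and> {x, y} \<subseteq> S} \<le> n ^ (k - 3)" if "x \<noteq> y" for x y
  proof -
    have "card {S. S \<subseteq> {..<n} \<and> card S = k - 1 \<and> {x, y} \<subseteq> S} \<le> n ^ (k - 1 - card {x, y})"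
      using that k by (intro card_supersets_le) auto
    also have "k - 1 - card {x, y} = k - 3" using that k by simp
    finally show ?thesis .
  qed
  have cF: "card F \<le> D * n ^ (k - 1)"
  proof -
    have "card F \<le> D * card {S. S \<subseteq> {..<n} \<and> card S = k - 1}"
      by (rule card_fibres_le[where c = c, OF _ _ fib finF]) (use F in auto)
    also have "\<dots> \<le> D * n ^ (k - 1)"
      using card_supersets_le[of "{}" "k - 1" n] by simp
    finally show ?thesis .
  qed
  have tbad: "t * card (bad z) \<le> (k - 1) * card {e\<in>F. a e = z}" for z
  proof -
    have "t * card (bad z) = (\<Sum>x\<in>bad z. t)" by simp
    also have "\<dots> \<le> (\<Sum>x\<in>bad z. d z x)" by (intro sum_mono) (simp add: bad_def)
    also have "\<dots> \<le> (\<Sum>x\<in>{..<n}. d z x)" by (intro sum_mono2) (auto simp: bad_def)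
    also have "\<dots> = (\<Sum>x\<in>{..<n}. card {e\<in>{e\<in>F. a e = z}. x \<in> c e})"
      unfolding d_def by (intro sum.cong arg_cong[where f = card]) auto
    also have "\<dots> = (\<Sum>e\<in>{e\<in>F. a e = z}. k - 1)"
    proof (rule sum_multicount_gen)
      show "\<forall>e\<in>{e\<in>F. a e = z}. card {x\<in>{..<n}. x \<in> c e} = k - 1"
      proof
        fix e assume "e \<in> {e\<in>F. a e = z}"
        then have "{x\<in>{..<n}. x \<in> c e} = c e" "card (c e) = k - 1" using F by blast+
        then show "card {x\<in>{..<n}. x \<in> c e} = k - 1" by simp
      qed
    qed (use finF in simp_all)
    finally show ?thesis by (simp add: mult.commute)
  qed
  have "(\<Sum>z\<in>{..<n}. card {e\<in>F. z = a e}) = (\<Sum>e\<in>F. 1)"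
  proof (rule sum_multicount_gen)
    show "\<forall>e\<in>F. card {z\<in>{..<n}. z = a e} = 1"
    proof
      fix e assume "e \<in> F"
      then have "{z\<in>{..<n}. z = a e} = {a e}" using F by blast
      then show "card {z\<in>{..<n}. z = a e} = 1" by simp
    qed
  qed (use finF in simp_all)
  then have "(\<Sum>z\<in>{..<n}. card {e\<in>F. a e = z}) = card F" by (simp add: eq_commute)
  then have sum_tbad: "(\<Sum>z\<in>{..<n}. t * card (bad z)) \<le> (k - 1) * (D * n ^ (k - 1))"
  proof -
    have "(\<Sum>z\<in>{..<n}. t * card (bad z)) \<le> (\<Sum>z\<in>{..<n}. (k - 1) * card {e\<in>F. a e = z})"
      by (intro sum_mono tbad)
    also have "\<dots> = (k - 1) * card F"
      using \<open>(\<Sum>z\<in>{..<n}. card {e\<in>F. a e = z}) = card F\<close> by (simp only: sum_distrib_left[symmetric])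
    also have "\<dots> \<le> (k - 1) * (D * n ^ (k - 1))" using cF by (rule mult_left_mono) simp
    finally show ?thesis .
  qed
  have cFb: "card Fb \<le> (\<Sum>z\<in>{..<n}. card (bad z) * card (bad z) * n ^ (k - 3))"
  proof -
    let ?E = "\<lambda>z p. {e\<in>F. a e = z \<and> fst p \<noteq> snd p \<and> {fst p, snd p} \<subseteq> c e}"
    let ?D = "\<lambda>z. \<Union>p\<in>bad z \<times> bad z. ?E z p"
    have E: "card (?E z p) \<le> n ^ (k - 3)" for z p
    proof (cases "fst p = snd p")
      case False
      \<comment> \<open>For a fixed centre an edge is recovered from \<open>c e\<close>, so counting
        \<open>(k - 1)\<close>-sets through two vertices costs no factor \<open>D\<close>.\<close>
      have "card (?E z p) \<le> card {S. S \<subseteq> {..<n} \<and> card S = k - 1 \<and> {fst p, snd p} \<subseteq> S}"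
      proof (rule card_inj_on_le[where f = c])
        show "inj_on c (?E z p)"
        proof (rule inj_onI)
          fix e e' assume "e \<in> ?E z p" "e' \<in> ?E z p" "c e = c e'"
          moreover from this have "e = insert (a e) (c e)" "e' = insert (a e') (c e')" using F by blast+
          ultimately show "e = e'" by simp
        qed
        show "c ` ?E z p \<subseteq> {S. S \<subseteq> {..<n} \<and> card S = k - 1 \<and> {fst p, snd p} \<subseteq> S}"
          using F by blast
      qed simp
      also have "\<dots> \<le> n ^ (k - 3)" by (rule above) fact
      finally show ?thesis .
    qed simp
    have "Fb \<subseteq> (\<Union>z\<in>{..<n}. ?D z)"
    proof
      fix e assume "e \<in> Fb"
      then have e: "e \<in> F" "2 \<le> card (c e \<inter> bad (a e))" by (auto simp: Fb_def)
      obtain T where T: "T \<subseteq> c e \<inter> bad (a e)" "card T = 2"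
        using e(2) obtain_subset_with_card_n by metis
      then obtain x y where "x \<noteq> y" "T = {x, y}" by (auto simp: card_2_iff)
      then have "(x, y) \<in> bad (a e) \<times> bad (a e)" "e \<in> ?E (a e) (x, y)" using T e(1) by auto
      then have "e \<in> ?D (a e)" by blast
      moreover have "a e \<in> {..<n}" using F[OF e(1)] by simp
      ultimately show "e \<in> (\<Union>z\<in>{..<n}. ?D z)" by blast
    qed
    then have "card Fb \<le> card (\<Union>z\<in>{..<n}. ?D z)" using finF finbad by (intro card_mono) auto
    also have "\<dots> \<le> (\<Sum>z\<in>{..<n}. card (?D z))" by (rule card_UN_le) simp
    also have "\<dots> \<le> (\<Sum>z\<in>{..<n}. card (bad z) * card (bad z) * n ^ (k - 3))"
    proof (intro sum_mono)
      fix z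
      have "card (?D z) \<le> (\<Sum>p\<in>bad z \<times> bad z. card (?E z p))"
        by (rule card_UN_le) (use finbad in simp)
      also have "\<dots> \<le> (\<Sum>p\<in>bad z \<times> bad z. n ^ (k - 3))" by (intro sum_mono E)
      finally show "card (?D z) \<le> card (bad z) * card (bad z) * n ^ (k - 3)"
        by (simp add: card_cartesian_product)
    qed
    finally show ?thesis .
  qed
  \<comment> \<open>In the sum of squares one factor \<open>t * card (bad z)\<close> is bounded by
    its maximum \<open>(k - 1) * q\<close>, and the other is summed over all centres by
    \<open>sum_tbad\<close>.\<close>
  have t2Fb: "t\<^sup>2 * card Fb \<le> (k - 1)\<^sup>2 * q * D * n ^ (k - 1) * n ^ (k - 3)"
  proof -
    have "t\<^sup>2 * card Fb \<le> t\<^sup>2 * (\<Sum>z\<in>{..<n}. card (bad z) * card (bad z) * n ^ (k - 3))"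
      using cFb by (rule mult_left_mono) simp
    also have "\<dots> = (\<Sum>z\<in>{..<n}. (t * card (bad z)) * (t * card (bad z))) * n ^ (k - 3)"
      by (simp add: sum_distrib_left sum_distrib_right power2_eq_square mult_ac)
    also have "\<dots> \<le> (\<Sum>z\<in>{..<n}. ((k - 1) * q) * (t * card (bad z))) * n ^ (k - 3)"
    proof (intro mult_right_mono sum_mono)
      fix z
      show "t * card (bad z) \<le> (k - 1) * q"
        using order.trans[OF tbad mult_left_mono[OF small]] by simp
    qed simp_all
    also have "\<dots> = ((k - 1) * q) * (\<Sum>z\<in>{..<n}. t * card (bad z)) * n ^ (k - 3)"
      by (simp only: sum_distrib_left)
    also have "\<dots> \<le> ((k - 1) * q) * ((k - 1) * (D * n ^ (k - 1))) * n ^ (k - 3)"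
      using sum_tbad by (intro mult_right_mono mult_left_mono) simp_all
    finally show ?thesis by (simp add: power2_eq_square mult_ac)
  qed
  have "Fb \<subseteq> F" by (simp add: Fb_def)
  then have cdiff: "card F = card (F - Fb) + card Fb"
    using finF by (metis card_Diff_subset card_mono finite_subset le_add_diff_inverse2)
  \<comment> \<open>With the edges having two bad vertices discarded, enough remain to peel at
    threshold \<open>C * b\<close> over \<open>n\<close> vertices.\<close>
  have "t\<^sup>2 * (n * (C * b)) < t\<^sup>2 * card (F - Fb)"
    using large t2Fb unfolding cdiff b_def[symmetric] by (simp only: distrib_left)
  then have "card {..<n} * (C * b) < card (F - Fb)" by simp
  then obtain P where P: "P \<subseteq> F - Fb" "P \<noteq> {}"
      "\<And>e x. e \<in> P \<Longrightarrow> x \<in> good e \<Longrightarrow> C * b < card {e'\<in>P. x \<in> good e'}"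
  proof (rule dense_subfamily[rotated 3, where G = good])
    show "good e \<subseteq> {..<n}" if "e \<in> F - Fb" for e using F[of e] that by (auto simp: good_def)
  qed (use finF in auto)
  have PF: "P \<subseteq> F" using P(1) by blast
  have "flexible k C P good"
  proof (rule flexible_if_degrees)
    show "finite P" using PF finF by (rule finite_subset)
  next
    fix e assume e: "e \<in> P"
    then have eF: "e \<in> F" using PF by blast
    have "card (c e \<inter> bad (a e)) \<le> 1" using e P(1) by (auto simp: Fb_def)
    moreover have "good e = c e - bad (a e)" using F[OF eF] by (auto simp: good_def bad_def)
    then have "card (good e) = card (c e) - card (c e \<inter> bad (a e))"
      using finc[OF eF] by (simp add: card_Diff_subset_Int)
    ultimately have two: "2 \<le> card (good e)" using F[OF eF] k by linarith
    have ae: "a e \<notin> c e" "card (c e) = k - 1" "e = insert (a e) (c e)"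
      using F[OF eF] by blast+
    have "card (insert (a e) (c e)) = Suc (card (c e))"
      using finc[OF eF] ae(1) by (rule card_insert_disjoint)
    then have "card e = Suc (card (c e))" by (simp only: ae(3)[symmetric])
    then have "card e = k" using ae(2) k by linarith
    moreover have "finite e" using \<open>card e = k\<close> k by (metis card.infinite not_numeral_le_zero)
    moreover have "good e \<subseteq> e" using ae(3) by (auto simp: good_def)
    ultimately show "finite e \<and> card e = k \<and> good e \<subseteq> e \<and> 2 \<le> card (good e)" using two by blast
  next
    fix x u :: nat assume xu: "x \<noteq> u"
    let ?X1 = "{e\<in>F. {x, u} \<subseteq> c e}" and ?X2 = "{e\<in>F. a e = u \<and> x \<in> good e}"
    have "{e\<in>P. x \<in> good e \<and> u \<in> e} \<subseteq> ?X1 \<union> ?X2"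
    proof
      fix e assume "e \<in> {e\<in>P. x \<in> good e \<and> u \<in> e}"
      then have e: "e \<in> F" "x \<in> good e" "u \<in> e" using PF by auto
      then have "u = a e \<or> u \<in> c e" using F[OF e(1)] by blast
      then show "e \<in> ?X1 \<union> ?X2" using e by (auto simp: good_def)
    qed
    then have "card {e\<in>P. x \<in> good e \<and> u \<in> e} \<le> card (?X1 \<union> ?X2)"
      using finF by (intro card_mono) auto
    also have "\<dots> \<le> card ?X1 + card ?X2" by (rule card_Un_le)
    also have "card ?X1 \<le> D * n ^ (k - 3)"
    proof -
      have "card ?X1 \<le> D * card {S. S \<subseteq> {..<n} \<and> card S = k - 1 \<and> {x, u} \<subseteq> S}"
      proof (rule card_fibres_le[where c = c])
        fix S
        have "card {e\<in>?X1. c e = S} \<le> card {e\<in>F. c e = S}"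
          using finF by (intro card_mono) auto
        then show "card {e\<in>?X1. c e = S} \<le> D" using fib order.trans by blast
      qed (use F finF in auto)
      also have "\<dots> \<le> D * n ^ (k - 3)" using above[OF xu] by simp
      finally show ?thesis .
    qed
    also have "card ?X2 \<le> t"
    proof (cases "?X2 = {}")
      case False
      then obtain e where "e \<in> F" "a e = u" "x \<in> good e" by blast
      then have "d u x \<le> t" by (auto simp: good_def)
      moreover have "card ?X2 \<le> d u x"
        unfolding d_def using finF by (intro card_mono) (auto simp: good_def)
      ultimately show ?thesis by simp
    qed (simp only: card.empty)
    finally show "card {e\<in>P. x \<in> good e \<and> u \<in> e} \<le> b" by (simp add: b_def)
  qed (use P in simp_all)
  then show thesis using that PF by blast
qed

section \<open>Assembling the upper bound\<close>

text \<open>The three terms bound the edges with unpopular centres (\<open>N\<close> of them would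
  yield a flexible subfamily), the main part of the edges with popular centres, and the pigeonhole
  loss in \<open>common_link\<close>. The choice \<open>c\<close> has fibres of size at most
  \<open>C\<close>, so \<open>C\<close> also takes the place of \<open>D\<close>.\<close>

lemma card_copy_free_le:
  fixes V :: "'a set" and F :: "nat set set" and b n q t N :: nat
  assumes T: "forest V E" and k: "k \<ge> 4"
    and F: "F \<subseteq> {S. S \<subseteq> {..<n} \<and> card S = k}"
    and nocopy: "\<not> contains_copy F (expansion_vertices k V E) (expansion_edges k V E)"
    and C: "sigma V E + k * card E \<le> C"
    and N: "t\<^sup>2 * (n * (C * (C * n ^ (k - 3) + t))) + (k - 1)\<^sup>2 * q * C * n ^ (k - 1) * n ^ (k - 3)
              < t\<^sup>2 * N"
    and q: "0 < q" "C * n ^ (k - 1) \<le> b * q"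
  shows "card F \<le> N + (sigma V E - 1) * (n choose (k - 1)) + b * (2 ^ b * (C * n ^ (k - 2)))"
proof -
  have finF: "finite F" using F by (rule finite_subset) simp
  have Fk: "e \<subseteq> {..<n}" "finite e" "card e = k" if "e \<in> F" for e
    using that F finite_subset[of e "{..<n}"] by auto
  have Ck: "k * card E \<le> C" using C by simp
  let ?keys = "\<lambda>e. {S. S \<subseteq> e \<and> card S = k - 1}"
  have noflex: "\<not> flexible k C P G" if "P \<subseteq> F" for P G
    using contains_copy_if_flexible[OF T _ _ that Ck] k nocopy by force
  have nofull: "\<not> (\<exists>Q\<subseteq>F. Q \<noteq> {} \<and> (\<forall>e\<in>Q. \<forall>S\<in>?keys e. C < card {e'\<in>Q. S \<in> ?keys e'}))"
  proof (intro notI, elim exE conjE)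
    fix Q assume Q: "Q \<subseteq> F" "Q \<noteq> {}" "\<forall>e\<in>Q. \<forall>S\<in>?keys e. C < card {e'\<in>Q. S \<in> ?keys e'}"
    have "flexible k C Q (\<lambda>e. e)"
    proof (rule flexible_if_full)
      show "finite Q" using Q(1) finF by (rule finite_subset)
      show "finite e \<and> card e = k" if "e \<in> Q" for e using that Q(1) Fk by blast
      show "C < card {e'\<in>Q. S \<subseteq> e'}" if "e \<in> Q" "S \<subseteq> e" "card S = k - 1" for e S
        using Q(3) that by simp
    qed (use Q(2) k in simp_all)
    then show False using noflex[OF Q(1)] by blast
  qed
  have "\<exists>c. (\<forall>e\<in>F. c e \<in> ?keys e) \<and> (\<forall>S. card {e\<in>F. c e = S} \<le> C)"
    using dense_subfamily_or_sparse_choice[OF finF, of ?keys C] by (rule disjE) (erule notE[OF nofull], assumption)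
  then obtain c where c: "\<forall>e\<in>F. c e \<in> ?keys e" "\<forall>S. card {e\<in>F. c e = S} \<le> C"
    by (elim exE conjE)
  have "\<exists>z. z \<notin> c e \<and> e = insert z (c e)" if e: "e \<in> F" for e
  proof -
    have ce: "c e \<subseteq> e" "card (c e) = k - 1" using c(1) e by auto
    then have "card (e - c e) = 1"
      using Fk[OF e] k finite_subset[OF ce(1)] by (simp add: card_Diff_subset)
    then obtain z where "e - c e = {z}" by (rule card_1_singletonE)
    then have "z \<notin> c e \<and> e = insert z (c e)" using ce(1) by blast
    then show ?thesis by blast
  qed
  then obtain a where a: "\<forall>e\<in>F. a e \<notin> c e \<and> e = insert (a e) (c e)"
    using bchoice[of F "\<lambda>e z. z \<notin> c e \<and> e = insert z (c e)"] by blast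
  have ca: "c e \<subseteq> {..<n} \<and> card (c e) = k - 1 \<and> a e < n \<and> a e \<notin> c e \<and> e = insert (a e) (c e)"
    if e: "e \<in> F" for e
  proof -
    have "a e \<in> e" "c e \<subseteq> e" "card (c e) = k - 1" using a c(1) e by auto
    then show ?thesis using Fk(1)[OF e] a e by auto
  qed
  define B where "B = {z\<in>{..<n}. q < card {e\<in>F. a e = z}}"
  have finB: "finite B" by (simp add: B_def)
  have "card F \<le> C * card {S. S \<subseteq> {..<n} \<and> card S = k - 1}"
    by (rule card_fibres_le[where c = c, OF _ _ c(2)[rule_format] finF]) (use ca in auto)
  also have "\<dots> \<le> C * n ^ (k - 1)" using card_supersets_le[of "{}" "k - 1" n] by simp
  finally have cF: "card F \<le> C * n ^ (k - 1)" .
  \<comment> \<open>Edges are partitioned by their centres, so popular centres account for at least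
    \<open>card B * q\<close> of the at most \<open>b * q\<close> edges.\<close>
  have "card B * q \<le> (\<Sum>z\<in>B. card {e\<in>F. a e = z})"
    using sum_bounded_below[of B q "\<lambda>z. card {e\<in>F. a e = z}"] by (simp add: B_def less_imp_le)
  also have "\<dots> = card (\<Union>z\<in>B. {e\<in>F. a e = z})"
    using finB finF by (intro card_UN_disjoint[symmetric]) auto
  also have "\<dots> \<le> card F" using finF by (intro card_mono) auto
  also have "\<dots> \<le> b * q" using cF q(2) by simp
  finally have cB: "card B \<le> b" using q(1) by simp
  define F2 where "F2 = {e\<in>F. a e \<in> B}"
  define F1 where "F1 = F - F2"
  have "\<not> N \<le> card F1"
  proof
    assume "N \<le> card F1"
    then have large: "t\<^sup>2 * (n * (C * (C * n ^ (k - 3) + t))) +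
        (k - 1)\<^sup>2 * q * C * n ^ (k - 1) * n ^ (k - 3) < t\<^sup>2 * card F1"
      using N by (meson less_le_trans mult_le_mono2)
    have "F1 \<subseteq> F" by (simp add: F1_def)
    have "\<exists>P G. P \<subseteq> F1 \<and> flexible k C P G"
    proof (rule flexible_if_scattered_centres[OF _ k _ _ _ large])
      show "finite F1" using finF by (simp add: F1_def)
      show "c e \<subseteq> {..<n} \<and> card (c e) = k - 1 \<and> a e < n \<and> a e \<notin> c e \<and> e = insert (a e) (c e)"
        if "e \<in> F1" for e using ca that \<open>F1 \<subseteq> F\<close> by blast
      show "card {e\<in>F1. c e = S} \<le> C" for S
      proof -
        have "card {e\<in>F1. c e = S} \<le> card {e\<in>F. c e = S}"
          using finF \<open>F1 \<subseteq> F\<close> by (intro card_mono) auto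
        then show ?thesis using c(2) order.trans by blast
      qed
      show "card {e\<in>F1. a e = z} \<le> q" for z
      proof (cases "q < card {e\<in>F. a e = z}")
        case True
        then have "{e\<in>F1. a e = z} = {}" using ca by (auto simp: F1_def F2_def B_def)
        then show ?thesis by (simp only: card.empty)
      next
        case False
        have "card {e\<in>F1. a e = z} \<le> card {e\<in>F. a e = z}"
          using finF \<open>F1 \<subseteq> F\<close> by (intro card_mono) auto
        then show ?thesis using False by simp
      qed
    qed blast
    then show False using noflex \<open>F1 \<subseteq> F\<close> by (meson order.trans)
  qed
  \<comment> \<open>A common link with more than \<open>C * n ^ (k - 2)\<close> sets of size
    \<open>k - 1\<close> contains a flexible family, so this is the value of \<open>M\<close> in
    \<open>common_link\<close>.\<close>
  moreover have "\<not> (sigma V E - 1) * (n choose (k - 1)) + card B * (2 ^ card B * (C * n ^ (k - 2))) < card F2"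
  proof
    assume large: "(sigma V E - 1) * (n choose (k - 1)) + card B * (2 ^ card B * (C * n ^ (k - 2))) < card F2"
    obtain Z where Z: "Z \<subseteq> B" "card Z = sigma V E"
      "C * n ^ (k - 2) < card {S. S \<subseteq> {..<n} \<and> card S = k - 1 \<and> (\<forall>z\<in>Z. insert z S \<in> F)}"
    proof (rule common_link[OF finB refl _ large])
      show "e \<in> F \<and> c e \<subseteq> {..<n} \<and> card (c e) = k - 1 \<and> a e \<in> B \<and> a e \<notin> c e \<and> e = insert (a e) (c e)"
        if "e \<in> F2" for e using that ca[of e] by (simp add: F2_def)
    qed
    let ?L = "{S. S \<subseteq> {..<n} \<and> card S = k - 1 \<and> (\<forall>z\<in>Z. insert z S \<in> F)}"
    have "k - 1 - 1 = k - 2" by simp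
    then have "C * n ^ (k - 1 - 1) < card ?L" using Z(3) by simp
    then obtain P where P: "P \<subseteq> ?L" "flexible (k - 1) C P (\<lambda>S. S)"
      by (rule flexible_subfamily[rotated 2]) (use k in auto)
    have "contains_copy F (expansion_vertices k V E) (expansion_edges k V E)"
    proof (rule contains_copy_if_flexible_link[OF T _ P(2) _ Z(2)])
      show "finite Z" using Z(1) finB by (rule finite_subset)
      have "(k - 1) * card E \<le> k * card E" by simp
      then show "sigma V E + (k - 1) * card E \<le> C" using C by linarith
    qed (use k P(1) in auto)
    then show False using nocopy by simp
  qed
  moreover have "card F = card F1 + card F2"
  proof -
    have "F2 \<subseteq> F" by (simp add: F2_def)
    then show ?thesis unfolding F1_def using finF
      by (metis card_Diff_subset card_mono finite_subset le_add_diff_inverse2)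
  qed
  moreover have "card B * (2 ^ card B * (C * n ^ (k - 2))) \<le> b * (2 ^ b * (C * n ^ (k - 2)))"
    using cB power_increasing[OF cB, of "2 :: nat"] by (intro mult_le_mono) simp_all
  ultimately show ?thesis by linarith
qed

section \<open>Choice of the parameters\<close>

text \<open>Here \<open>t\<close>, \<open>q\<close> and \<open>N\<close> have orders \<open>n\<^sup>k\<^sup>-\<^sup>2\<close>, \<open>n\<^sup>k\<^sup>-\<^sup>1\<close> and \<open>n\<^sup>k\<^sup>-\<^sup>1\<close>.\<close>
lemma threshold_parameters:
  fixes \<epsilon> :: real and C k :: nat
  assumes \<epsilon>: "\<epsilon> > 0" and C: "C \<ge> 1" and k: "k \<ge> 4"
  obtains b n0 :: nat where
    "\<And>n. n \<ge> n0 \<Longrightarrow> \<exists>t q N.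
       t\<^sup>2 * (n * (C * (C * n ^ (k - 3) + t))) + (k - 1)\<^sup>2 * q * C * n ^ (k - 1) * n ^ (k - 3) < t\<^sup>2 * N \<and>
       0 < q \<and> C * n ^ (k - 1) \<le> b * q \<and> real N \<le> \<epsilon> * real n ^ (k - 1)"
proof -
  \<comment> \<open>Since \<open>t\<close> is at most \<open>\<delta>' * n ^ (k - 2)\<close>, this
    choice makes \<open>n * C * t\<close> at most
    \<open>\<epsilon> / 8 * n ^ (k - 1)\<close>.\<close>
  define \<delta>' where "\<delta>' = \<epsilon> / (8 * real C)"
  \<comment> \<open>With \<open>q\<close> at most \<open>\<delta> * n ^ (k - 1)\<close>, the second
    summand stays below \<open>t\<^sup>2 * \<epsilon> / 4 * n ^ (k - 1)\<close>, even though
    rounding may halve \<open>t\<close>.\<close>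
  define \<delta> where "\<delta> = \<delta>'\<^sup>2 * \<epsilon> / (32 * (real (k - 1))\<^sup>2 * real C)"
  \<comment> \<open>The factor \<open>2\<close> allows for rounding in \<open>q\<close>.\<close>
  define b where "b = nat \<lceil>2 * real C / \<delta>\<rceil>"
  \<comment> \<open>From \<open>n0\<close> on, rounding changes \<open>t\<close>, \<open>q\<close>
    and \<open>N\<close> by at most a factor \<open>2\<close>, and
    \<open>C\<^sup>2 * n ^ (k - 2)\<close> is at most
    \<open>\<epsilon> / 8 * n ^ (k - 1)\<close>.\<close>
  define n0 where "n0 = nat \<lceil>max (max 1 (max (2 / \<delta>') (2 / \<delta>))) (max (2 / \<epsilon>) (8 * (real C)\<^sup>2 / \<epsilon>))\<rceil>"
  have pos: "\<delta>' > 0" "\<delta> > 0" "real C \<ge> 1" "real (k - 1) > 0"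
    using assms by (auto simp: \<delta>'_def \<delta>_def)
  have "\<exists>t q N.
       t\<^sup>2 * (n * (C * (C * n ^ (k - 3) + t))) + (k - 1)\<^sup>2 * q * C * n ^ (k - 1) * n ^ (k - 3) < t\<^sup>2 * N \<and>
       0 < q \<and> C * n ^ (k - 1) \<le> b * q \<and> real N \<le> \<epsilon> * real n ^ (k - 1)" if n: "n \<ge> n0" for n
  proof -
    define x where "x = real n"
    define y where "y = x ^ (k - 3)"
    have "max (max 1 (max (2 / \<delta>') (2 / \<delta>))) (max (2 / \<epsilon>) (8 * (real C)\<^sup>2 / \<epsilon>)) \<le> x"
      using n unfolding n0_def x_def by linarith
    then have x: "1 \<le> x" "2 / \<delta>' \<le> x" "2 / \<delta> \<le> x" "2 / \<epsilon> \<le> x" "8 * (real C)\<^sup>2 / \<epsilon> \<le> x" by auto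
    have y: "y \<ge> 1" using x(1) by (simp add: y_def)
    have "k - 1 = Suc (Suc (k - 3))" using k by simp
    then have xk: "real n ^ (k - 1) = x * x * y" by (simp add: x_def y_def)
    define t where "t = nat \<lfloor>\<delta>' * (x * y)\<rfloor>"
    define q where "q = nat \<lfloor>\<delta> * (x * x * y)\<rfloor>"
    define N where "N = nat \<lceil>\<epsilon> / 2 * (x * x * y)\<rceil>"
    have xy: "x \<le> x * y" "x \<le> x * x * y"
    proof -
      show "x \<le> x * y" using x(1) y by simp
      then have "1 * x \<le> x * (x * y)" using x(1) by (intro mult_mono) auto
      then show "x \<le> x * x * y" by (simp add: mult.assoc)
    qed
    have big: "2 \<le> \<delta>' * (x * y)" "2 \<le> \<delta> * (x * x * y)" "2 \<le> \<epsilon> * (x * x * y)"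
    proof -
      have "2 \<le> \<delta>' * x" "2 \<le> \<delta> * x" "2 \<le> \<epsilon> * x"
        using x(2-4) pos \<epsilon> by (simp_all add: divide_le_eq mult.commute)
      moreover have "\<delta>' * x \<le> \<delta>' * (x * y)" "\<delta> * x \<le> \<delta> * (x * x * y)" "\<epsilon> * x \<le> \<epsilon> * (x * x * y)"
        using xy pos \<epsilon> by (intro mult_left_mono; simp)+
      ultimately show "2 \<le> \<delta>' * (x * y)" "2 \<le> \<delta> * (x * x * y)" "2 \<le> \<epsilon> * (x * x * y)" by linarith+
    qed
    have t: "real t \<le> \<delta>' * (x * y)" "\<delta>' * (x * y) / 2 \<le> real t" using big(1) unfolding t_def by linarith+
    have q: "real q \<le> \<delta> * (x * x * y)" "\<delta> * (x * x * y) / 2 \<le> real q" "0 < q"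
      using big(2) unfolding q_def by linarith+
    have N: "\<epsilon> / 2 * (x * x * y) \<le> real N" "real N \<le> \<epsilon> * (x * x * y)"
      using big(3) unfolding N_def by linarith+
    have "real C * (x * x * y) \<le> real b * real q"
    proof -
      have "real C * (x * x * y) = 2 * real C / \<delta> * (\<delta> * (x * x * y) / 2)" using pos by simp
      also have "\<dots> \<le> real b * real q"
      proof (rule mult_mono)
        show "2 * real C / \<delta> \<le> real b" unfolding b_def by (rule real_nat_ceiling_ge)
      qed (use q(2) pos x(1) y in simp_all)
      finally show ?thesis .
    qed
    then have "real (C * n ^ (k - 1)) \<le> real (b * q)"
      by (simp only: of_nat_mult of_nat_power xk)
    then have 1: "C * n ^ (k - 1) \<le> b * q" by (simp only: of_nat_le_iff)
    have "x * (real C * (real C * y + real t)) \<le> \<epsilon> / 4 * (x * x * y)"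
    proof -
      have "x * (real C * (real C * y + real t)) \<le> x * (real C * (real C * y + \<delta>' * (x * y)))"
        using t(1) x(1) by (intro mult_left_mono add_left_mono) auto
      also have "\<dots> = (real C)\<^sup>2 * (x * y) + \<epsilon> / 8 * (x * x * y)"
        using pos by (simp add: \<delta>'_def power2_eq_square field_simps)
      also have "(real C)\<^sup>2 * (x * y) \<le> (\<epsilon> / 8 * x) * (x * y)"
        using x(1,5) y \<epsilon> by (intro mult_right_mono) (auto simp: field_simps)
      finally show ?thesis by (simp add: algebra_simps)
    qed
    then have A: "(real t)\<^sup>2 * (x * (real C * (real C * y + real t))) \<le> (real t)\<^sup>2 * (\<epsilon> / 4 * (x * x * y))"
      by (rule mult_left_mono) simp
    have cancel: "m\<^sup>2 * (z / (32 * m\<^sup>2 * w)) * w = z / 32" if "m > 0" "w > 0" for m w z :: real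
      using that by (simp add: field_simps)
    have \<delta>_eq: "(real (k - 1))\<^sup>2 * \<delta> * real C = \<delta>'\<^sup>2 * \<epsilon> / 32"
      unfolding \<delta>_def using pos(3,4) by (intro cancel) linarith+
    have "(real (k - 1))\<^sup>2 * real q * real C * (x * x * y) * y
        \<le> (real (k - 1))\<^sup>2 * (\<delta> * (x * x * y)) * real C * (x * x * y) * y"
      using q(1) x(1) y by (intro mult_right_mono mult_left_mono) auto
    also have "\<dots> = \<delta>'\<^sup>2 * \<epsilon> / 32 * ((x * y)\<^sup>2 * (x * x * y))"
      unfolding \<delta>_eq[symmetric] by (simp only: power2_eq_square mult_ac)
    also have "\<dots> < \<delta>'\<^sup>2 * \<epsilon> / 16 * ((x * y)\<^sup>2 * (x * x * y))"
      using pos \<epsilon> x(1) y by (intro mult_strict_right_mono) auto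
    also have "\<dots> = (\<delta>' * (x * y) / 2)\<^sup>2 * (\<epsilon> / 4 * (x * x * y))" by (simp add: power2_eq_square)
    also have "\<dots> \<le> (real t)\<^sup>2 * (\<epsilon> / 4 * (x * x * y))"
      using t(2) pos \<epsilon> x(1) y by (intro mult_right_mono power_mono) auto
    \<comment> \<open>Each summand takes \<open>\<epsilon> / 4\<close>, together the
      \<open>\<epsilon> / 2\<close> in the definition of \<open>N\<close>.\<close>
    finally have "(real t)\<^sup>2 * (x * (real C * (real C * y + real t))) +
        (real (k - 1))\<^sup>2 * real q * real C * (x * x * y) * y < (real t)\<^sup>2 * (\<epsilon> / 2 * (x * x * y))"
      using A by (simp add: algebra_simps)
    also have "\<dots> \<le> (real t)\<^sup>2 * real N" using N(1) by (intro mult_left_mono) auto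
    finally have "real (t\<^sup>2 * (n * (C * (C * n ^ (k - 3) + t))) +
        (k - 1)\<^sup>2 * q * C * n ^ (k - 1) * n ^ (k - 3)) < real (t\<^sup>2 * N)"
      unfolding of_nat_mult of_nat_add of_nat_power xk by (simp only: x_def y_def)
    then have "t\<^sup>2 * (n * (C * (C * n ^ (k - 3) + t))) +
        (k - 1)\<^sup>2 * q * C * n ^ (k - 1) * n ^ (k - 3) < t\<^sup>2 * N" by (simp only: of_nat_less_iff)
    then show ?thesis using 1 q(3) N(2) unfolding xk by blast
  qed
  then show thesis using that by blast
qed

section \<open>Lower bound and limit\<close>

lemma sigma_le:
  assumes "graph V E" "independent V E X"
  shows "sigma V E \<le> card X + card {e\<in>E. e \<inter> X = {}}"
proof -
  have "finite {X. independent V E X}" using assms(1) by (simp add: graph_def independent_def)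
  then show ?thesis unfolding sigma_def using assms(2) by (intro Min_le) auto
qed

text \<open>A crosscut of size \<open>sigma V E\<close> has to meet an edge, so it is not empty;
  \<open>3\<close> is the least uniformity covered by \<open>sigma_crosscut\<close>.\<close>

lemma sigma_pos:
  assumes "graph V E" "E \<noteq> {}"
  shows "sigma V E \<ge> 1"
proof -
  obtain e where e: "e \<in> E" using assms(2) by blast
  obtain K :: "('a + 'a set \<times> nat) set" where K: "K \<subseteq> expansion_vertices 3 V E" "card K = sigma V E"
      "\<And>e. e \<in> E \<Longrightarrow> \<exists>w. expand 3 e \<inter> K = {w}"
    using sigma_crosscut[OF assms(1), of 3] by auto
  have "finite K" using K(1) finite_expansion_vertices[OF assms(1)] finite_subset by blast
  moreover have "K \<noteq> {}" using K(3)[OF e] by blast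
  ultimately show ?thesis using K(2) by (simp add: Suc_le_eq card_gt_0_iff flip: K(2))
qed

text \<open>The preimage of \<open>{..<j}\<close> meets every edge of the expansion exactly once.\<close>
lemma star_copy_free:
  assumes gr: "graph V E" and j: "j < sigma V E"
    and F: "\<And>S. S \<in> F \<Longrightarrow> \<exists>i. S \<inter> {..<j} = {i}"
  shows "\<not> contains_copy F (expansion_vertices k V E) (expansion_edges k V E)"
proof
  let ?W = "expansion_vertices k V E"
  assume "contains_copy F ?W (expansion_edges k V E)"
  then obtain f where f: "inj_on f ?W" "\<And>e. e \<in> E \<Longrightarrow> f ` expand k e \<in> F"
    unfolding contains_copy_def expansion_edges_eq by blast
  define K where "K = {w\<in>?W. f w < j}"
  \<comment> \<open>Two ends of an edge in \<open>X\<close> would give two points of its image in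
    \<open>{..<j}\<close>, so \<open>X\<close> is independent. An edge missed by \<open>X\<close>
    must meet \<open>K\<close> in a new vertex. The aim is
    \<open>sigma V E \<le> card X + card M \<le> card K \<le> j\<close>.\<close>
  define X where "X = {v\<in>V. f (Inl v) < j}"
  define M where "M = {e\<in>E. e \<inter> X = {}}"
  have finW: "finite ?W" using gr by (rule finite_expansion_vertices)
  have "card K \<le> card {..<j}"
    by (rule card_inj_on_le[of f]) (use f(1) in \<open>auto simp: K_def inj_on_def\<close>)
  then have cK: "card K \<le> j" by simp
  have "independent V E X"
    unfolding independent_def
  proof (intro conjI ballI notI)
    fix e assume e: "e \<in> E" "e \<subseteq> X"
    obtain x y where xy: "x \<noteq> y" "x \<in> V" "y \<in> V" "e = {x, y}" using gr e(1) by (auto simp: graph_def)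
    obtain i where i: "f ` expand k e \<inter> {..<j} = {i}" using F[OF f(2)[OF e(1)]] by blast
    have "f (Inl x) \<in> f ` expand k e \<inter> {..<j}" "f (Inl y) \<in> f ` expand k e \<inter> {..<j}"
      using xy e(2) by (auto simp: expand_def X_def)
    then have "f (Inl x) = f (Inl y)" unfolding i by simp
    moreover have "Inl x \<in> ?W" "Inl y \<in> ?W" using xy by (auto simp: expansion_vertices_def)
    ultimately have "Inl x = (Inl y :: 'a + 'a set \<times> nat)" using f(1) by (meson inj_onD)
    then show False using xy(1) by simp
  qed (auto simp: X_def)
  then have le: "sigma V E \<le> card X + card M" unfolding M_def by (rule sigma_le[OF gr])
  have "\<exists>i. Inr (e, i) \<in> K" if e: "e \<in> M" for e
  proof -
    have eE: "e \<in> E" "e \<inter> X = {}" using e by (auto simp: M_def)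
    obtain i where "f ` expand k e \<inter> {..<j} = {i}" using F[OF f(2)[OF eE(1)]] by blast
    then have "i \<in> f ` expand k e" "i < j" by blast+
    then obtain w where w: "w \<in> expand k e" "f w < j" by blast
    have "w \<in> K" using w expand_subset_vertices[OF gr eE(1)] by (auto simp: K_def)
    moreover have "w \<notin> Inl ` e"
      using w(2) eE graph_edge(1)[OF gr eE(1)] by (auto simp: X_def)
    then obtain i where "w = Inr (e, i)" using w(1) by (auto simp: expand_def)
    ultimately show ?thesis by blast
  qed
  then obtain \<iota> where \<iota>: "\<And>e. e \<in> M \<Longrightarrow> Inr (e, \<iota> e) \<in> K" by metis
  have finK: "finite K" using finW by (simp add: K_def)
  have "finite X" "finite M"
    using gr graph_finite_edges[OF gr] by (auto simp: X_def M_def graph_def)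
  \<comment> \<open>Chosen new vertices of distinct edges are distinct because they carry the edge
    as label.\<close>
  then have "card X + card M = card (Inl ` X :: ('a + 'a set \<times> nat) set) +
      card ((\<lambda>e. Inr (e, \<iota> e)) ` M :: ('a + 'a set \<times> nat) set)"
    by (simp add: card_image inj_on_def)
  also have "\<dots> = card (Inl ` X \<union> (\<lambda>e. Inr (e, \<iota> e)) ` M)"
    using \<open>finite X\<close> \<open>finite M\<close> by (intro card_Un_disjoint[symmetric]) auto
  also have "\<dots> \<le> card K"
    using finK \<iota> by (intro card_mono) (auto simp: X_def K_def expansion_vertices_def)
  finally show False using le cK j by simp
qed

lemma finite_copy_free_cards:
  "finite (card ` {F. F \<subseteq> {S. S \<subseteq> {..<n::nat} \<and> card S = k} \<and> \<not> contains_copy F W H})"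
proof -
  have "finite (Pow {S. S \<subseteq> {..<n} \<and> card S = k})" by simp
  then show ?thesis by (rule finite_imageI[OF finite_subset[rotated]]) blast
qed

text \<open>Sets \<open>insert i S\<close> with \<open>i < j\<close> and
  \<open>S \<subseteq> {j..<n}\<close> meet \<open>{..<j}\<close> exactly once, so they form no
  copy, and both \<open>i\<close> and \<open>S\<close> can be read off from them.\<close>

lemma ex_k_ge:
  assumes gr: "graph V E" and k: "k \<ge> 1" and j: "j < sigma V E" and "j \<le> n"
  shows "j * ((n - j) choose (k - 1)) \<le> ex_k k n (expansion_vertices k V E) (expansion_edges k V E)"
proof -
  define SS where "SS = {S. S \<subseteq> {j..<n} \<and> card S = k - 1}"
  define F where "F = (\<lambda>(i, S). insert i S) ` ({..<j} \<times> SS)"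
  have disj: "S \<inter> {..<j} = {}" if "S \<in> SS" for S using that by (auto simp: SS_def)
  have "inj_on (\<lambda>(i, S). insert i S) ({..<j} \<times> SS)"
  proof (rule inj_onI, clarify)
    fix i S i' S' assume h: "i < j" "i' < j" "S \<in> SS" "S' \<in> SS" "insert i S = insert i' S'"
    have 1: "insert i S \<inter> {..<j} = {i}" "insert i' S' \<inter> {..<j} = {i'}"
      using h disj by auto
    have 2: "insert i S - {..<j} = S" "insert i' S' - {..<j} = S'"
      using h disj by blast+
    show "i = i' \<and> S = S'" using 1 2 h(5) by (metis singleton_inject)
  qed
  then have "card F = j * card SS" unfolding F_def by (simp add: card_image card_cartesian_product)
  also have "card SS = (n - j) choose (k - 1)" using n_subsets[of "{j..<n}" "k - 1"] by (simp add: SS_def)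
  finally have cF: "card F = j * ((n - j) choose (k - 1))" .
  have "F \<subseteq> {S. S \<subseteq> {..<n} \<and> card S = k}"
  proof
    fix e assume "e \<in> F"
    then obtain i S where e: "e = insert i S" "i < j" "S \<in> SS" by (auto simp: F_def)
    then have "i \<notin> S" "S \<subseteq> {..<n}" "card S = k - 1" using disj by (auto simp: SS_def)
    moreover have "finite S" using \<open>S \<subseteq> {..<n}\<close> finite_subset by blast
    ultimately show "e \<in> {S. S \<subseteq> {..<n} \<and> card S = k}" using e \<open>j \<le> n\<close> k by auto
  qed
  moreover have "\<not> contains_copy F (expansion_vertices k V E) (expansion_edges k V E)"
  proof (rule star_copy_free[OF gr j])
    fix e assume "e \<in> F"
    then obtain i S where e: "e = insert i S" "i < j" "S \<in> SS" by (auto simp: F_def)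
    then have "e \<inter> {..<j} = {i}" using disj[OF e(3)] by auto
    then show "\<exists>i. e \<inter> {..<j} = {i}" by blast
  qed
  ultimately show ?thesis
    unfolding ex_k_def cF[symmetric] by (intro Max_ge finite_copy_free_cards imageI) simp
qed

lemma ex_k_le:
  assumes "H \<noteq> {}"
    and "\<And>F. F \<subseteq> {S. S \<subseteq> {..<n} \<and> card S = k} \<Longrightarrow> \<not> contains_copy F W H \<Longrightarrow> card F \<le> m"
  shows "ex_k k n W H \<le> m"
proof -
  \<comment> \<open>The empty family is admissible because \<open>H\<close> has an edge, so the
    \<open>Max\<close> ranges over a nonempty set.\<close>
  have "\<not> contains_copy {} W H" using assms(1) by (auto simp: contains_copy_def)
  then have "{} \<in> {F. F \<subseteq> {S. S \<subseteq> {..<n} \<and> card S = k} \<and> \<not> contains_copy F W H}" by simp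
  then show ?thesis
    unfolding ex_k_def using assms(2) by (intro Max.boundedI finite_copy_free_cards) auto
qed

section \<open>Passage to the limit\<close>

text \<open>An \<open>r\<close>-set not inside \<open>{j..<n}\<close> contains one of the
  \<open>j\<close> smaller points, and each point lies in at most \<open>n ^ (r - 1)\<close> of the
  \<open>r\<close>-sets.\<close>

lemma binomial_diff_ge:
  assumes "r \<ge> 1"
  shows "n choose r \<le> ((n - j) choose r) + j * n ^ (r - 1)"
proof -
  let ?A = "{S. S \<subseteq> {j..<n} \<and> card S = r}"
  let ?B = "\<lambda>i. {S. S \<subseteq> {..<n} \<and> card S = r \<and> {i} \<subseteq> S}"
  have "n choose r = card {S. S \<subseteq> {..<n} \<and> card S = r}" using n_subsets[of "{..<n}" r] by simp
  also have "\<dots> \<le> card (?A \<union> (\<Union>i\<in>{..<j}. ?B i))"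
  proof (rule card_mono)
    show "finite (?A \<union> (\<Union>i\<in>{..<j}. ?B i))" by simp
    show "{S. S \<subseteq> {..<n} \<and> card S = r} \<subseteq> ?A \<union> (\<Union>i\<in>{..<j}. ?B i)"
    proof
      fix S assume S: "S \<in> {S. S \<subseteq> {..<n} \<and> card S = r}"
      show "S \<in> ?A \<union> (\<Union>i\<in>{..<j}. ?B i)"
      proof (cases "\<exists>i\<in>S. i < j")
        case True
        then show ?thesis using S by blast
      next
        case False
        then have "S \<subseteq> {j..<n}" using S by (fastforce simp: not_less)
        then show ?thesis using S by blast
      qed
    qed
  qed
  also have "\<dots> \<le> card ?A + card (\<Union>i\<in>{..<j}. ?B i)" by (rule card_Un_le)
  also have "card (\<Union>i\<in>{..<j}. ?B i) \<le> (\<Sum>i\<in>{..<j}. card (?B i))" by (rule card_UN_le) simp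
  also have "\<dots> \<le> (\<Sum>i\<in>{..<j}. n ^ (r - 1))"
    using assms card_supersets_le[of "{i}" r n for i] by (intro sum_mono) simp
  also have "card ?A = (n - j) choose r" using n_subsets[of "{j..<n}" r] by simp
  finally show ?thesis by simp
qed

theorem theorem4p1:
  fixes V :: "'a set" and E :: "'a set set" and k :: nat
  assumes "forest V E" and "E \<noteq> {}" and "k \<ge> 4"
  shows "(\<lambda>n. real (ex_k k n (expansion_vertices k V E) (expansion_edges k V E))
              / real (n choose (k - 1)))
         \<longlonglongrightarrow> real (sigma V E) - 1"
proof (rule LIMSEQ_I)
  fix r :: real assume r: "0 < r"
  have gr: "graph V E" using assms(1) by (simp add: forest_def)
  define j where "j = sigma V E - 1"
  \<comment> \<open>The \<open>Suc\<close> makes \<open>C \<ge> 1\<close> immediate, as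
    \<open>threshold_parameters\<close> requires.\<close>
  define C where "C = Suc (sigma V E + k * card E)"
  \<comment> \<open>For \<open>n \<ge> k\<close>, \<open>\<kappa> * n ^ (k - 1)\<close> is a lower
    bound for \<open>n choose (k - 1)\<close>; it turns errors of order \<open>n ^ (k - 1)\<close>
    into fractions of the binomial coefficient.\<close>
  define \<kappa> where "\<kappa> = (1 / real (k - 1)) ^ (k - 1)"
  define ex where "ex n = ex_k k n (expansion_vertices k V E) (expansion_edges k V E)" for n
  have j: "j < sigma V E" "real (sigma V E) - 1 = real j"
    using sigma_pos[OF gr assms(2)] by (auto simp: j_def)
  have \<kappa>: "\<kappa> > 0" using assms(3) by (simp add: \<kappa>_def)
  have par_pos: "r * \<kappa> / 4 > 0" "C \<ge> 1" using r \<kappa> by (simp_all add: C_def)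
  obtain b n0 :: nat where par: "\<And>n. n \<ge> n0 \<Longrightarrow> \<exists>t q N.
       t\<^sup>2 * (n * (C * (C * n ^ (k - 3) + t))) + (k - 1)\<^sup>2 * q * C * n ^ (k - 1) * n ^ (k - 3) < t\<^sup>2 * N \<and>
       0 < q \<and> C * n ^ (k - 1) \<le> b * q \<and> real N \<le> r * \<kappa> / 4 * real n ^ (k - 1)"
    by (rule threshold_parameters[OF par_pos assms(3)]) (rule that, blast)
  define A where "A = real (b * 2 ^ b * C)"
  \<comment> \<open>The last two entries absorb the terms of order \<open>n ^ (k - 2)\<close>:
    \<open>A * y\<close> in the upper bound and \<open>j * j * y\<close> in the lower one. The outer
    \<open>Suc\<close> makes the last inequality strict.\<close>
  define n1 where "n1 = Max {n0, k, j, nat \<lceil>4 * A / (r * \<kappa>)\<rceil>, Suc (nat \<lceil>real j * real j / (r * \<kappa>)\<rceil>)}"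
  show "\<exists>no. \<forall>n\<ge>no. norm (real (ex_k k n (expansion_vertices k V E) (expansion_edges k V E))
              / real (n choose (k - 1)) - (real (sigma V E) - 1)) < r"
  proof (intro exI[of _ n1] allI impI)
    fix n assume "n \<ge> n1"
    then have n: "n \<ge> n0" "n \<ge> k" "n \<ge> j" "4 * A / (r * \<kappa>) \<le> real n" "real j * real j / (r * \<kappa>) < real n"
      unfolding n1_def by (auto simp: nat_le_iff ceiling_le_iff Suc_le_eq, linarith+)
    define y where "y = real n ^ (k - 2)"
    define c where "c = real (n choose (k - 1))"
    have n_pos: "real n > 0" and y: "y > 0" using n(2) assms(3) by (auto simp: y_def)
    have "k - 1 = Suc (k - 2)" using assms(3) by simp
    then have pw: "real n ^ (k - 1) = real n * y" by (simp add: y_def)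
    have "(real n / real (k - 1)) ^ (k - 1) \<le> c"
      unfolding c_def by (rule binomial_ge_n_over_k_pow_k) (use n(2) in simp)
    then have c: "\<kappa> * (real n * y) \<le> c" unfolding \<kappa>_def pw[symmetric] by (simp add: power_divide)
    then have c_pos: "c > 0" using mult_pos_pos[OF \<kappa> mult_pos_pos[OF n_pos y]] by linarith
    obtain t q N where tq: "t\<^sup>2 * (n * (C * (C * n ^ (k - 3) + t))) +
        (k - 1)\<^sup>2 * q * C * n ^ (k - 1) * n ^ (k - 3) < t\<^sup>2 * N"
      "0 < q" "C * n ^ (k - 1) \<le> b * q" "real N \<le> r * \<kappa> / 4 * real n ^ (k - 1)"
      using par[OF n(1)] by blast
    have "ex n \<le> N + j * (n choose (k - 1)) + b * (2 ^ b * (C * n ^ (k - 2)))"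
      unfolding ex_def
    proof (rule ex_k_le)
      show "expansion_edges k V E \<noteq> {}" using assms(2) by (simp add: expansion_edges_eq)
    next
      fix F assume F: "F \<subseteq> {S. S \<subseteq> {..<n} \<and> card S = k}"
        "\<not> contains_copy F (expansion_vertices k V E) (expansion_edges k V E)"
      show "card F \<le> N + j * (n choose (k - 1)) + b * (2 ^ b * (C * n ^ (k - 2)))"
        unfolding j_def by (rule card_copy_free_le[OF assms(1,3) F _ tq(1-3)]) (simp add: C_def)
    qed
    then have "real (ex n) \<le> real (N + j * (n choose (k - 1)) + b * (2 ^ b * (C * n ^ (k - 2))))"
      by (simp only: of_nat_le_iff)
    also have "\<dots> = real N + real j * c + A * y" by (simp add: c_def A_def y_def)
    also have "real N \<le> r / 4 * c"
    proof -
      have "real N \<le> r / 4 * (\<kappa> * (real n * y))" using tq(4) unfolding pw by simp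
      also have "\<dots> \<le> r / 4 * c" using c r by (intro mult_left_mono) auto
      finally show ?thesis .
    qed
    also have "A * y \<le> r / 4 * c"
    proof -
      have "A \<le> r * \<kappa> / 4 * real n" using n(4) r \<kappa> by (simp add: field_simps)
      then have "A * y \<le> r * \<kappa> / 4 * real n * y" using y by (intro mult_right_mono) auto
      also have "\<dots> = r / 4 * (\<kappa> * (real n * y))" by simp
      also have "\<dots> \<le> r / 4 * c" using c r by (intro mult_left_mono) auto
      finally show ?thesis .
    qed
    finally have "real (ex n) \<le> (real j + r / 2) * c" by (simp add: algebra_simps)
    also have "\<dots> < (real j + r) * c" using r c_pos by (intro mult_strict_right_mono) auto
    finally have upper: "real (ex n) < (real j + r) * c" .
    \<comment> \<open>Lower bound: passing from \<open>n\<close> to \<open>n - j\<close> costs at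
      most \<open>j * y\<close> in the binomial coefficient, and \<open>j\<close> times this is
      below \<open>r * c\<close>.\<close>
    have "n choose (k - 1) \<le> ((n - j) choose (k - 1)) + j * n ^ (k - 1 - 1)"
      using assms(3) by (intro binomial_diff_ge) simp
    then have "real (n choose (k - 1)) \<le> real (((n - j) choose (k - 1)) + j * n ^ (k - 1 - 1))"
      by (simp only: of_nat_le_iff)
    also have "k - 1 - 1 = k - 2" by simp
    finally have "c \<le> real ((n - j) choose (k - 1)) + real j * y" by (simp add: c_def y_def)
    then have "real j * c \<le> real j * (real ((n - j) choose (k - 1)) + real j * y)"
      by (rule mult_left_mono) simp
    also have "\<dots> = real (j * ((n - j) choose (k - 1))) + real j * real j * y" by (simp add: algebra_simps)
    also have "real (j * ((n - j) choose (k - 1))) \<le> real (ex n)"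
      unfolding ex_def using ex_k_ge[OF gr _ j(1) n(3), of k] assms(3) by (simp only: of_nat_le_iff)
    also have "real j * real j * y < r * c"
    proof -
      have "real j * real j < r * \<kappa> * real n" using n(5) r \<kappa> by (simp add: field_simps)
      then have "real j * real j * y < r * \<kappa> * real n * y" using y by (rule mult_strict_right_mono)
      also have "\<dots> = r * (\<kappa> * (real n * y))" by simp
      also have "\<dots> \<le> r * c" using c r by (intro mult_left_mono) auto
      finally show ?thesis .
    qed
    finally have lower: "(real j - r) * c < real (ex n)" by (simp add: algebra_simps)
    have "real (ex n) / c < real j + r" "real j - r < real (ex n) / c"
      using upper lower c_pos by (simp_all add: pos_divide_less_eq pos_less_divide_eq)
    then have "norm (real (ex n) / c - real j) < r" by (simp add: abs_less_iff)
    then show "norm (real (ex_k k n (expansion_vertices k V E) (expansion_edges k V E))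
              / real (n choose (k - 1)) - (real (sigma V E) - 1)) < r"
      by (simp only: ex_def c_def j(2))
  qed
qed

end
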